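(* Let $a_1 = 2$, $a_2 = 1$, $a_n = a_{n-1} + a_{n-2}$ for all $n \geq 3$, and let $F_{(2,1)} = \{a_1,a_2,a_3,\ldots\} = \{2,1,3,4,7,11,\ldots\} \subset \mathbb{N}$ be the set of Lucas numbers. Then: (i) there exists $s$ with $0 < s < \dim_H(J_{F_{(2,1)}})$ such that $[0,s] \subset DS(F_{(2,1)})$; (ii) there exist $a, b$ with $0 < a < b < \dim_H(J_{F_{(2,1)}})$ such that $(a,b) \cap DS(F_{(2,1)}) = \varnothing$.
   Context: $\mathbb{N}$ denotes the set of positive integers. For positive integers $b_1, b_2, \ldots$, let $[b_1,b_2,\ldots] := \cfrac{1}{b_1+\cfrac{1}{b_2+\cfrac{1}{b_3+\cdots}}}$ denote the infinite continued fraction (an irrational number in $[0,1]$). For $\Lambda \subseteq \mathbb{N}$, define $J_\Lambda := \{x = [b_1,b_2,\ldots] : b_i \in \Lambda \text{ for all } i\} \subset [0,1]$. $\dim_H$ denotes Hausdorff dimension (with $\dim_H(\varnothing)=0$). For an infinite set $\Lambda \subseteq \mathbb{N}$, the dimension spectrum of $\Lambda$ is $DS(\Lambda) := \{\dim_H(J_A) : A \subseteq \Lambda\}$, where $A$ ranges over all (finite or infinite) subsets of $\Lambda$. *)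

theory Defs
  imports "HOL-Analysis.Analysis"
begin

section \<open>Hausdorff dimension\<close>

text \<open>
  The term \<open>|U|^s\<close> of a covering sum, with the usual conventions that the empty set contributes
  nothing and that \<open>|U|^0 = 1\<close> for every nonempty \<open>U\<close>; the latter is made explicit because
  \<open>0 powr 0 = 0\<close> in HOL.
\<close>
definition diam_pow :: "real \<Rightarrow> 'a::metric_space set \<Rightarrow> ennreal" where
  "diam_pow s U =
     (if U = {} then 0 else if s = 0 then 1 else ennreal (diameter U powr s))"

text \<open>
  Boundedness is required separately because \<^const>\<open>diameter\<close> is real-valued and
  carries no information on unbounded sets. Finite covers are included by padding with the
  empty set.
\<close>
definition delta_covers :: "real \<Rightarrow> 'a::metric_space set \<Rightarrow> (nat \<Rightarrow> 'a set) set" where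
  "delta_covers \<delta> E =
     {U. E \<subseteq> (\<Union>i. U i) \<and> (\<forall>i. bounded (U i) \<and> diameter (U i) \<le> \<delta>)}"

definition hausdorff_premeasure :: "real \<Rightarrow> real \<Rightarrow> 'a::metric_space set \<Rightarrow> ennreal" where
  "hausdorff_premeasure s \<delta> E = (INF U \<in> delta_covers \<delta> E. \<Sum>i. diam_pow s (U i))"

definition hausdorff_measure :: "real \<Rightarrow> 'a::metric_space set \<Rightarrow> ennreal" where
  "hausdorff_measure s E = (SUP \<delta> \<in> {0<..}. hausdorff_premeasure s \<delta> E)"

text \<open>
  On a Euclidean space the set below is nonempty (it contains every \<open>s\<close> larger than the dimension
  of the space) and bounded below by 0, so the real-valued infimum is the true one. The empty set
  has dimension 0.
\<close>
definition hausdorff_dim :: "'a::euclidean_space set \<Rightarrow> real" where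
  "hausdorff_dim E = Inf {s. 0 \<le> s \<and> hausdorff_measure s E = 0}"


section \<open>Continued fractions\<close>

text \<open>
  Digit sequences are indexed from 0: \<open>b i\<close> is the partial quotient usually written
  \<open>b_(i+1)\<close>, and \<open>cf_convergent b n\<close> is the finite continued fraction
  \<open>[b 0, ..., b (n - 1)]\<close> (with value 0 for \<open>n = 0\<close>).
\<close>
primrec cf_convergent :: "(nat \<Rightarrow> nat) \<Rightarrow> nat \<Rightarrow> real" where
  "cf_convergent b 0 = 0"
| "cf_convergent b (Suc n) = 1 / (real (b 0) + cf_convergent (\<lambda>i. b (Suc i)) n)"

text \<open>The limit exists whenever all digits are positive, the only case of interest.\<close>
definition cf_value :: "(nat \<Rightarrow> nat) \<Rightarrow> real" where
  "cf_value b = lim (cf_convergent b)"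

text \<open>Meant for sets \<open>\<Lambda>\<close> of positive integers.\<close>
definition cf_set :: "nat set \<Rightarrow> real set" where
  "cf_set \<Lambda> = {cf_value b |b. \<forall>i. b i \<in> \<Lambda>}"

definition dim_spectrum :: "nat set \<Rightarrow> real set" where
  "dim_spectrum \<Lambda> = {hausdorff_dim (cf_set A) |A. A \<subseteq> \<Lambda>}"


section \<open>Lucas numbers\<close>

text \<open>Indexed from 0: the sequence \<open>a_1 = 2, a_2 = 1, a_3 = 3, ...\<close> is \<open>a_n = lucas (n - 1)\<close>.\<close>
fun lucas :: "nat \<Rightarrow> nat" where
  "lucas 0 = 2"
| "lucas (Suc 0) = 1"
| "lucas (Suc (Suc n)) = lucas (Suc n) + lucas n"

definition lucas_set :: "nat set" where
  "lucas_set = range lucas"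

end

theory Submission
  imports Defs
begin

text \<open>
  Let \<open>q(w)\<close> be the continuant of a finite word \<open>w\<close>. The dimension of the set of continued fractions
  with digits in \<open>A\<close> is the critical exponent of the sums of \<open>q(w) powr (-2 * s)\<close> over the words of
  length \<open>k\<close>: if one of them is below 1, covering by cylinders bounds the dimension by \<open>s\<close>, and if
  none is, finite subsets of \<open>A\<close> have dimension arbitrarily close to \<open>s\<close>. Since \<open>q(u c v)\<close> equals
  \<open>q(u) q(v) (c + t)\<close> with \<open>t \<in> {0..2}\<close>, two digit sets are compared by comparing the sums of
  \<open>(c + t) powr (-2 * s)\<close> over single digits.

  For \<open>s \<le> 1/4\<close> a Lucas number contributes less than the next two together, so that choosing digits
  greedily attains every dimension in \<open>{0..1/4}\<close>. For \<open>s \<ge> 37/50\<close> each of the first ten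
  Lucas numbers, the last of which is 76, contributes more than all Lucas numbers after 76 together.
  Hence omitting one of these ten digits forces the dimension below that of the ten digits alone,
  which is at least 3/4, by a fixed amount.
\<close>

section \<open>Continued fraction branches\<close>

text \<open>The constants of the gap depend on one another. Digit sets are compared slightly below
  the dimension of the ten digits, and \<open>37 / 50\<close> is \<open>3 / 4 - 1 / 100\<close>,
  which leaves room for a loss of \<open>1 / 100\<close>. At that exponent the tail is summed as a
  geometric series, and the ratio of this series has to stay below \<open>1 / 2\<close> for every
  shift \<open>t \<le> 2\<close>. A growth rate of \<open>8 / 5\<close>, just below the golden
  ratio, is enough; but the shifted quotients of consecutive Lucas numbers stay above it only from
  76 on, which fixes the number ten. Lower bounds for the dimension meet two obstacles: separating
  the cylinders takes compactness, hence a finite alphabet, and distortion costs a constant factor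
  \<open>4 powr s\<close>. Both are overcome by lowering the exponent by an arbitrarily small
  amount: sums over long words then gain an exponential factor, and a finite truncation keeps the
  strict inequality.\<close>

fun cmap :: "nat list \<Rightarrow> real \<Rightarrow> real" where
  "cmap [] x = x"
| "cmap (c # w) x = 1 / (real c + cmap w x)"

text \<open>
  \<open>cmap w\<close> is a Moebius transformation and \<open>cden w\<close> its denominator, so that \<open>cden w 0\<close> is the
  continuant of \<open>w\<close>.
\<close>
fun cden :: "nat list \<Rightarrow> real \<Rightarrow> real" where
  "cden [] x = 1"
| "cden (c # w) x = (real c + cmap w x) * cden w x"

lemma cmap_append: "cmap (u @ v) x = cmap u (cmap v x)"
  by (induction u) auto

lemma cden_append: "cden (u @ v) x = cden u (cmap v x) * cden v x"
  by (induction u) (auto simp: cmap_append)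

lemma pos_digit: "0 \<notin> set (c # w) \<Longrightarrow> 1 \<le> real c"
  by (cases c) auto

lemma cmap_nonneg: "0 \<le> x \<Longrightarrow> 0 \<le> cmap w x"
  by (induction w) auto

lemma cmap_le_1:
  assumes "0 \<notin> set w" "0 \<le> x" "x \<le> 1"
  shows "cmap w x \<le> 1"
proof (cases w)
  case (Cons c v)
  then show ?thesis
    using pos_digit[of c v] assms cmap_nonneg[of x v] by (simp add: field_simps)
qed (use assms in auto)

lemma cmap_open_unit:
  assumes "0 \<notin> set w" "0 < x" "x < 1"
  shows "0 < cmap w x \<and> cmap w x < 1"
  using assms
proof (induction w)
  case (Cons c w)
  then show ?case using pos_digit[of c w] by (simp add: field_simps)
qed auto

text \<open>The strict bounds matter: \<open>1 / (c + 1)\<close> arises from digit \<open>c\<close>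
  at the point 1 and from digit \<open>c + 1\<close> at the point 0. Inside the open interval the
  leading digit can be read off.\<close>

lemma cmap_inj:
  assumes "0 < x" "x < 1" "0 < y" "y < 1" "0 \<notin> set u" "0 \<notin> set v"
    and "length u = length v" "cmap u x = cmap v y"
  shows "u = v"
  using assms(7,5,6,8)
proof (induction u v rule: list_induct2)
  case (Cons c u d v)
  have u: "0 < cmap u x" "cmap u x < 1" and v: "0 < cmap v y" "cmap v y < 1"
    using cmap_open_unit assms Cons by auto
  have e: "real c + cmap u x = real d + cmap v y"
    using Cons.prems u v by (auto simp: field_simps)
  then have "\<bar>real c - real d\<bar> < 1" using u v by linarith
  then have "c = d" by linarith
  then show ?case using e Cons by auto
qed simp

lemma cden_ge_1:
  assumes "0 \<notin> set w" "0 \<le> x"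
  shows "1 \<le> cden w x"
  using assms
proof (induction w)
  case (Cons c w)
  then have "1 \<le> cden w x" "1 \<le> real c + cmap w x"
    using cmap_nonneg[of x w] pos_digit[of c w] by auto
  then show ?case
    using mult_mono[of 1 "real c + cmap w x" 1 "cden w x"] by auto
qed simp

lemma cden_pos: "0 \<notin> set w \<Longrightarrow> 0 \<le> x \<Longrightarrow> 0 < cden w x"
  using cden_ge_1[of w x] by linarith

text \<open>With consecutive continuants, \<open>cden w x\<close> is q_n + q_(n-1) x, and
  \<open>y\<close> is the quotient q_(n-1) / q_n. Appending a digit \<open>c\<close> on the right
  turns \<open>y\<close> into \<open>1 / (c + y)\<close>, hence the reverse induction.\<close>

lemma cden_affine:
  assumes "0 \<notin> set w"
  shows "\<exists>y. 0 \<le> y \<and> y \<le> 1 \<and> (\<forall>x\<ge>0. cden w x = cden w 0 * (1 + y * x))"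
  using assms
proof (induction w rule: rev_induct)
  case Nil
  then show ?case by (intro exI[of _ 0]) auto
next
  case (snoc c w)
  then obtain y where y: "0 \<le> y" "y \<le> 1" "\<And>x. 0 \<le> x \<Longrightarrow> cden w x = cden w 0 * (1 + y * x)"
    by auto
  have c: "1 \<le> real c" using snoc.prems by (intro pos_digit[of c "[]"]) auto
  have e: "cden (w @ [c]) x = cden w 0 * (real c + x + y)" if "0 \<le> x" for x
  proof -
    have "cden (w @ [c]) x = cden w 0 * (1 + y * (1 / (real c + x))) * (real c + x)"
      using y(3)[of "1 / (real c + x)"] c that by (simp add: cden_append)
    also have "\<dots> = cden w 0 * (real c + x + y)"
      using c that by (simp add: field_simps)
    finally show ?thesis .
  qed
  show ?case
  proof (intro exI[of _ "1 / (real c + y)"] conjI allI impI)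
    fix x :: real assume x: "0 \<le> x"
    have "cden w 0 * (real c + x + y) = cden w 0 * (real c + y) * (1 + 1 / (real c + y) * x)"
      using c y(1) by (simp add: field_simps)
    then show "cden (w @ [c]) x = cden (w @ [c]) 0 * (1 + 1 / (real c + y) * x)"
      using e[OF x] e[of 0] by simp
  next
    show "0 \<le> 1 / (real c + y)" "1 / (real c + y) \<le> 1" using c y(1) by auto
  qed
qed

text \<open>Bounded distortion with constant 2. Squared, it becomes the factor 4 of
  \<open>cmap_diff_ge\<close> and finally the \<open>4 powr s\<close> in the lower bound for the
  dimension.\<close>

lemma cden_bounds:
  assumes "0 \<notin> set w" "0 \<le> x" "x \<le> 1"
  shows "cden w 0 \<le> cden w x" "cden w x \<le> 2 * cden w 0"
proof -
  obtain y where y: "0 \<le> y" "y \<le> 1" "cden w x = cden w 0 * (1 + y * x)"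
    using cden_affine[OF assms(1)] assms by blast
  have p: "0 < cden w 0" using cden_pos assms by auto
  have "y * x \<le> 1 * 1" using y assms by (intro mult_mono) auto
  moreover have "0 \<le> y * x" using y assms by auto
  ultimately show "cden w 0 \<le> cden w x" "cden w x \<le> 2 * cden w 0"
    using p unfolding y(3) by (auto simp: mult_le_cancel_left mult.commute)
qed

lemma cden_append_ge:
  assumes "0 \<notin> set u" "0 \<notin> set v"
  shows "cden u 0 * cden v 0 \<le> cden (u @ v) 0"
  using assms cden_bounds(1)[of u "cmap v 0"] cmap_nonneg[of 0 v] cmap_le_1[of v 0] cden_pos[of v 0]
  by (auto simp: cden_append mult_right_mono)

text \<open>The shift \<open>t\<close> is the sum of \<open>cmap v 0\<close>, coming from the digits
  on the right, and of the quotient of continuants of \<open>u\<close> from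
  \<open>cden_affine\<close>, each at most 1. It does not depend on \<open>c\<close>, so one
  \<open>t\<close> serves the whole sum over the digit in this position.\<close>

lemma cden_split:
  assumes "0 \<notin> set u" "0 \<notin> set v"
  obtains t where "0 \<le> t" "t \<le> 2"
    "\<And>c. 0 < c \<Longrightarrow> cden (u @ c # v) 0 = cden u 0 * cden v 0 * (real c + t)"
proof -
  obtain y where y: "0 \<le> y" "y \<le> 1" "\<And>x. 0 \<le> x \<Longrightarrow> cden u x = cden u 0 * (1 + y * x)"
    using cden_affine[OF assms(1)] by blast
  define z where "z = cmap v 0"
  have z: "0 \<le> z" "z \<le> 1" using assms cmap_nonneg cmap_le_1 by (auto simp: z_def)
  have "cden (u @ c # v) 0 = cden u 0 * cden v 0 * (real c + (z + y))" if "0 < c" for c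
  proof -
    have c: "0 < real c + z" using that z by auto
    have "cden (u @ c # v) 0 = cden u (1 / (real c + z)) * ((real c + z) * cden v 0)"
      by (simp add: cden_append z_def)
    also have "\<dots> = cden u 0 * (1 + y * (1 / (real c + z))) * ((real c + z) * cden v 0)"
      using y(3)[of "1 / (real c + z)"] c by simp
    also have "\<dots> = cden u 0 * cden v 0 * (real c + (z + y))"
      using c by (simp add: field_simps)
    finally show ?thesis .
  qed
  then show ?thesis using that[of "z + y"] y(1,2) z by simp
qed

text \<open>A Moebius map of determinant 1 or -1 scales distances by the reciprocal of the product
  of its denominators at the two points.\<close>

lemma cmap_diff:
  assumes "0 \<notin> set w" "0 \<le> x" "0 \<le> y"
  shows "\<bar>cmap w x - cmap w y\<bar> = \<bar>x - y\<bar> / (cden w x * cden w y)"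
  using assms
proof (induction w)
  case (Cons c w)
  let ?X = "real c + cmap w x" and ?Y = "real c + cmap w y"
  have p: "0 < ?X" "0 < ?Y"
    using cmap_nonneg[of x w] cmap_nonneg[of y w] pos_digit[of c w] Cons.prems by linarith+
  have "cmap (c # w) x - cmap (c # w) y = (cmap w y - cmap w x) / (?X * ?Y)"
    using p by (simp add: field_simps)
  then have "\<bar>cmap (c # w) x - cmap (c # w) y\<bar> = \<bar>cmap w x - cmap w y\<bar> / (?X * ?Y)"
    using p by (simp add: abs_mult abs_minus_commute)
  also have "\<dots> = \<bar>x - y\<bar> / (cden (c # w) x * cden (c # w) y)"
    using Cons by (simp add: field_simps)
  finally show ?case .
qed simp

lemma cmap_diff_le:
  assumes "0 \<notin> set w" "0 \<le> x" "x \<le> 1" "0 \<le> y" "y \<le> 1"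
  shows "\<bar>cmap w x - cmap w y\<bar> \<le> 1 / (cden w 0)\<^sup>2"
proof -
  have p: "0 < cden w 0" using cden_pos assms by auto
  have "\<bar>x - y\<bar> / (cden w x * cden w y) \<le> 1 / (cden w 0 * cden w 0)"
    using assms p cden_bounds(1)[of w x] cden_bounds(1)[of w y]
    by (intro frac_le mult_mono mult_pos_pos) auto
  then show ?thesis using cmap_diff assms by (simp add: power2_eq_square)
qed

lemma cmap_diff_ge:
  assumes "0 \<notin> set w" "0 \<le> x" "x \<le> 1" "0 \<le> y" "y \<le> 1"
  shows "\<bar>x - y\<bar> / (4 * (cden w 0)\<^sup>2) \<le> \<bar>cmap w x - cmap w y\<bar>"
proof -
  have p: "0 < cden w 0" "0 < cden w x" "0 < cden w y" using cden_pos assms by auto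
  have "cden w x * cden w y \<le> (2 * cden w 0) * (2 * cden w 0)"
    using assms p cden_bounds(2)[of w x] cden_bounds(2)[of w y] by (intro mult_mono) auto
  then have "\<bar>x - y\<bar> / (4 * (cden w 0)\<^sup>2) \<le> \<bar>x - y\<bar> / (cden w x * cden w y)"
    using p by (intro divide_left_mono) (auto simp: power2_eq_square)
  then show ?thesis using cmap_diff assms by simp
qed

text \<open>A single digit 1 may leave the continuant unchanged, but two digits at least double it;
  hence \<open>div 2\<close> and an induction in steps of two.\<close>

lemma cden_growth:
  assumes "0 \<notin> set w"
  shows "2 ^ (length w div 2) \<le> cden w 0"
  using assms
proof (induction w rule: induct_list012)
  case (3 a b w)
  have p: "0 \<le> cmap w 0" "0 < real b + cmap w 0"
    using cmap_nonneg[of 0 w] pos_digit[of b w] 3 by auto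
  have "cden (a # b # w) 0 = (real a * (real b + cmap w 0) + 1) * cden w 0"
    using p by (simp add: field_simps)
  also have "\<dots> \<ge> 2 * cden w 0"
  proof (intro mult_right_mono)
    have "1 * 1 \<le> real a * (real b + cmap w 0)"
      using p pos_digit[of b w] pos_digit[of a "b#w"] 3 by (intro mult_mono) auto
    then show "2 \<le> real a * (real b + cmap w 0) + 1" by simp
  qed (use cden_pos[of w 0] 3 in auto)
  finally show ?case using 3 by auto
qed auto

lemma cden_le:
  assumes "0 \<notin> set w" "\<And>c. c \<in> set w \<Longrightarrow> real c + 1 \<le> M" "1 \<le> M"
  shows "cden w 0 \<le> M ^ length w"
  using assms
proof (induction w)
  case (Cons c w)
  have "cmap w 0 \<le> 1" using cmap_le_1[of w 0] Cons by auto
  then have "real c + cmap w 0 \<le> M" using Cons.prems(2)[of c] by auto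
  then show ?case
    using Cons cden_pos[of w 0] by (auto intro!: mult_mono)
qed simp


section \<open>Sums over words\<close>

definition words :: "nat set \<Rightarrow> nat \<Rightarrow> nat list set" where
  "words A k = {w. length w = k \<and> set w \<subseteq> A}"

text \<open>An integral with values in \<open>ennreal\<close> covers infinite alphabets and
  divergent sums alike, and sums can be exchanged freely.\<close>

definition word_sum :: "nat set \<Rightarrow> real \<Rightarrow> nat \<Rightarrow> ennreal" where
  "word_sum A s k = (\<integral>\<^sup>+w. ennreal (cden w 0 powr (-2 * s)) \<partial>count_space (words A k))"

definition digit_sum :: "nat set \<Rightarrow> real \<Rightarrow> real \<Rightarrow> ennreal" where
  "digit_sum A s t = (\<integral>\<^sup>+c. ennreal ((real c + t) powr (-2 * s)) \<partial>count_space A)"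

lemma words_0 [simp]: "words A 0 = {[]}"
  by (auto simp: words_def)

lemma words_pos: "0 \<notin> A \<Longrightarrow> w \<in> words A k \<Longrightarrow> 0 \<notin> set w"
  by (auto simp: words_def)

lemma finite_words: "finite A \<Longrightarrow> finite (words A k)"
  using finite_lists_length_eq[of A k] by (simp add: words_def conj_commute)

lemma word_sum_0 [simp]: "word_sum A s 0 = 1"
  by (simp add: word_sum_def nn_integral_count_space_finite)

lemma nn_integral_count_space_Times:
  fixes f :: "'a::countable \<Rightarrow> 'b::countable \<Rightarrow> ennreal"
  shows "(\<integral>\<^sup>+p. f (fst p) (snd p) \<partial>count_space (A \<times> B)) =
    (\<integral>\<^sup>+a. \<integral>\<^sup>+b. f a b \<partial>count_space B \<partial>count_space A)"
proof -
  interpret B: sigma_finite_measure "count_space B"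
    by (rule sigma_finite_measure_count_space_countable) auto
  have "(\<integral>\<^sup>+p. f (fst p) (snd p) \<partial>count_space (A \<times> B)) =
    (\<integral>\<^sup>+p. f (fst p) (snd p) \<partial>(count_space A \<Otimes>\<^sub>M count_space B))"
    by (subst pair_measure_countable) auto
  also have "\<dots> = (\<integral>\<^sup>+a. \<integral>\<^sup>+b. f a b \<partial>count_space B \<partial>count_space A)"
    by (subst B.nn_integral_fst[symmetric]) (auto simp: pair_measure_countable)
  finally show ?thesis .
qed

lemma nn_integral_words_append:
  "(\<integral>\<^sup>+w. f w \<partial>count_space (words A (m + n))) =
    (\<integral>\<^sup>+u. \<integral>\<^sup>+v. f (u @ v) \<partial>count_space (words A n) \<partial>count_space (words A m))"
proof -
  have b: "bij_betw (\<lambda>p. fst p @ snd p) (words A m \<times> words A n) (words A (m + n))"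
    by (rule bij_betwI[of _ _ _ "\<lambda>w. (take m w, drop m w)"])
       (auto simp: words_def dest: in_set_takeD in_set_dropD)
  show ?thesis
    unfolding nn_integral_bij_count_space[OF b, symmetric]
    by (rule nn_integral_count_space_Times)
qed

lemma nn_integral_words_Suc:
  "(\<integral>\<^sup>+w. f w \<partial>count_space (words A (Suc n))) =
    (\<integral>\<^sup>+c. \<integral>\<^sup>+v. f (c # v) \<partial>count_space (words A n) \<partial>count_space A)"
proof -
  have b: "bij_betw (\<lambda>p. fst p # snd p) (A \<times> words A n) (words A (Suc n))"
    by (rule bij_betwI[of _ _ _ "\<lambda>w. (hd w, tl w)"])
       (auto simp: words_def length_Suc_conv)
  show ?thesis
    unfolding nn_integral_bij_count_space[OF b, symmetric]
    by (rule nn_integral_count_space_Times)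
qed

text \<open>Continuants are supermultiplicative by \<open>cden_append_ge\<close>, and the negative
  exponent reverses the inequality. A single word sum below 1 therefore forces exponential decay
  along the multiples of its length.\<close>

lemma word_sum_submult:
  assumes "0 \<notin> A" "0 \<le> s"
  shows "word_sum A s (m + n) \<le> word_sum A s m * word_sum A s n"
proof -
  have le: "ennreal (cden (u @ v) 0 powr (-2 * s)) \<le>
    ennreal (cden u 0 powr (-2 * s)) * ennreal (cden v 0 powr (-2 * s))"
    if "u \<in> words A m" "v \<in> words A n" for u v
  proof -
    have uv: "0 \<notin> set u" "0 \<notin> set v" using words_pos assms that by auto
    then have p: "0 < cden u 0" "0 < cden v 0" using cden_pos by auto
    have "cden (u @ v) 0 powr (-2 * s) \<le> (cden u 0 * cden v 0) powr (-2 * s)"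
      using cden_append_ge[OF uv] p assms by (intro powr_mono2') auto
    then show ?thesis using p by (simp add: powr_mult flip: ennreal_mult)
  qed
  have "word_sum A s (m + n) \<le> (\<integral>\<^sup>+u. \<integral>\<^sup>+v. ennreal (cden u 0 powr (-2 * s)) *
     ennreal (cden v 0 powr (-2 * s)) \<partial>count_space (words A n) \<partial>count_space (words A m))"
    unfolding word_sum_def nn_integral_words_append using le by (intro nn_integral_mono) auto
  also have "\<dots> = word_sum A s m * word_sum A s n"
    by (simp add: word_sum_def nn_integral_cmult nn_integral_multc)
  finally show ?thesis .
qed

lemma word_sum_mult_le_power:
  assumes "0 \<notin> A" "0 \<le> s"
  shows "word_sum A s (m * k) \<le> word_sum A s k ^ m"
proof (induction m)
  case (Suc m)
  have "word_sum A s (Suc m * k) \<le> word_sum A s k * word_sum A s (m * k)"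
    using word_sum_submult[OF assms, of k "m * k"] by simp
  also have "\<dots> \<le> word_sum A s k * word_sum A s k ^ m" by (intro mult_left_mono Suc) auto
  finally show ?case by simp
qed simp

text \<open>
  Replacing the digits of a word one position at a time: by \<open>cden_split\<close> the sum over one digit,
  all others being fixed, is a multiple of \<open>digit_sum A s t\<close> for some \<open>t \<in> {0..2}\<close>.
\<close>
lemma word_sum_le_of_digit_sum:
  assumes A: "0 \<notin> A" and B: "0 \<notin> B"
    and le: "\<And>t. 0 \<le> t \<Longrightarrow> t \<le> 2 \<Longrightarrow> digit_sum B s t \<le> r * digit_sum A s t"
  shows "word_sum B s k \<le> r ^ k * word_sum A s k"
proof -
  let ?f = "\<lambda>w. ennreal (cden w 0 powr (-2 * s))"
  \<comment> \<open>The prefix \<open>u\<close> is general so that the induction hypothesis applies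
    to \<open>u @ [c]\<close>: the digits after \<open>c\<close> are exchanged first, then
    \<open>c\<close> itself between the fixed words \<open>u\<close> and \<open>v\<close>.\<close>
  have "(\<integral>\<^sup>+v. ?f (u @ v) \<partial>count_space (words B k)) \<le>
    r ^ k * (\<integral>\<^sup>+v. ?f (u @ v) \<partial>count_space (words A k))" if "0 \<notin> set u" for u
    using that
  proof (induction k arbitrary: u)
    case 0
    then show ?case by simp
  next
    case (Suc k)
    have one: "(\<integral>\<^sup>+c. ?f (u @ c # v) \<partial>count_space B) \<le> r * (\<integral>\<^sup>+c. ?f (u @ c # v) \<partial>count_space A)"
      if v: "v \<in> words A k" for v
    proof -
      have v0: "0 \<notin> set v" using words_pos A v by auto
      obtain t where t: "0 \<le> t" "t \<le> 2"
        "\<And>c. 0 < c \<Longrightarrow> cden (u @ c # v) 0 = cden u 0 * cden v 0 * (real c + t)"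
        using cden_split[OF Suc.prems v0] by blast
      let ?q = "ennreal ((cden u 0 * cden v 0) powr (-2 * s))"
      have p: "0 < cden u 0 * cden v 0" using cden_pos Suc.prems v0 by auto
      have e: "?f (u @ c # v) = ?q * ennreal ((real c + t) powr (-2 * s))" if "0 < c" for c
        using t that p by (simp add: powr_mult flip: ennreal_mult)
      have eq: "(\<integral>\<^sup>+c. ?f (u @ c # v) \<partial>count_space C) =
        ?q * digit_sum C s t" if "0 \<notin> C" for C
      proof -
        have "(\<integral>\<^sup>+c. ?f (u @ c # v) \<partial>count_space C) =
          (\<integral>\<^sup>+c. ?q * ennreal ((real c + t) powr (-2 * s)) \<partial>count_space C)"
          using that e by (intro nn_integral_cong) (metis gr0I space_count_space)
        then show ?thesis by (simp add: nn_integral_cmult digit_sum_def)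
      qed
      show ?thesis
        unfolding eq[OF A] eq[OF B] using mult_left_mono[OF le[OF t(1,2)], of ?q]
        by (simp add: ac_simps)
    qed
    let ?I = "\<lambda>C. \<integral>\<^sup>+c. \<integral>\<^sup>+v. ?f (u @ c # v) \<partial>count_space (words A k) \<partial>count_space C"
    have swap: "?I C = (\<integral>\<^sup>+v. \<integral>\<^sup>+c. ?f (u @ c # v) \<partial>count_space C \<partial>count_space (words A k))" for C
      by (subst nn_integral_count_space_nn_integral[of C "\<lambda>c v. ?f (u @ c # v)"]) simp_all
    have "?I B \<le> (\<integral>\<^sup>+v. r * (\<integral>\<^sup>+c. ?f (u @ c # v) \<partial>count_space A) \<partial>count_space (words A k))"
      unfolding swap by (intro nn_integral_mono one) auto
    also have "\<dots> = r * ?I A"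
      unfolding swap by (rule nn_integral_cmult) auto
    finally have BA: "?I B \<le> r * ?I A" .
    have "(\<integral>\<^sup>+v. ?f (u @ v) \<partial>count_space (words B (Suc k))) =
      (\<integral>\<^sup>+c. \<integral>\<^sup>+v. ?f ((u @ [c]) @ v) \<partial>count_space (words B k) \<partial>count_space B)"
      by (simp add: nn_integral_words_Suc)
    also have "\<dots> \<le> (\<integral>\<^sup>+c. r ^ k * (\<integral>\<^sup>+v. ?f ((u @ [c]) @ v) \<partial>count_space (words A k)) \<partial>count_space B)"
    proof (intro nn_integral_mono Suc.IH)
      fix c assume "c \<in> space (count_space B)"
      then have "c \<noteq> 0" using B by (metis space_count_space)
      then show "0 \<notin> set (u @ [c])" using Suc.prems by auto
    qed
    also have "\<dots> = r ^ k * ?I B"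
      by (subst nn_integral_cmult) auto
    also have "\<dots> \<le> r ^ k * (r * ?I A)"
      by (rule mult_left_mono[OF BA]) auto
    also have "\<dots> = r ^ Suc k * ?I A"
      by (simp only: power_Suc2 mult.assoc)
    finally show ?case
      unfolding nn_integral_words_Suc[where A = A] .
  qed
  note * = this[of "[]", unfolded append_Nil]
  show ?thesis unfolding word_sum_def by (rule *) simp
qed

section \<open>Values of continued fractions\<close>

lemma cf_convergent_add:
  "cf_convergent b (n + m) = cmap (map b [0..<n]) (cf_convergent (\<lambda>i. b (n + i)) m)"
proof (induction n arbitrary: b)
  case (Suc n)
  have "map b [0..<Suc n] = b 0 # map (\<lambda>i. b (Suc i)) [0..<n]"
    by (rule map_upt_Suc)
  then show ?case using Suc.IH[of "\<lambda>i. b (Suc i)"] by simp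
qed simp

lemma cf_convergent_unit:
  assumes "\<And>i. 0 < b i"
  shows "0 \<le> cf_convergent b n" "cf_convergent b n \<le> 1"
proof -
  have "0 \<notin> set (map b [0..<n])" using assms by (metis ex_map_conv less_irrefl)
  moreover have "cf_convergent b n = cmap (map b [0..<n]) 0"
    using cf_convergent_add[of b n 0] by simp
  ultimately show "0 \<le> cf_convergent b n" "cf_convergent b n \<le> 1"
    using cmap_nonneg[of 0] cmap_le_1[of _ 0] by auto
qed

text \<open>By \<open>cden_growth\<close> the diameter of a cylinder is bounded in terms of the
  length of its word alone, so \<open>N\<close> is uniform over all digits, also for infinite
  alphabets.\<close>

lemma cylinder_small:
  fixes e :: real
  assumes "0 < e"
  obtains N where "\<And>w x y. 0 \<notin> set w \<Longrightarrow> N \<le> length w \<Longrightarrow> 0 \<le> x \<Longrightarrow> x \<le> 1 \<Longrightarrow> 0 \<le> y \<Longrightarrow> y \<le> 1 \<Longrightarrow>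
    \<bar>cmap w x - cmap w y\<bar> < e"
proof -
  obtain M where M: "(1 / 2) ^ M < e"
    using real_arch_pow_inv[of e "1 / 2 :: real"] assms by auto
  show ?thesis
  proof (rule that[of "2 * M"])
    fix w :: "nat list" and x y :: real
    assume w: "0 \<notin> set w" "2 * M \<le> length w" and xy: "0 \<le> x" "x \<le> 1" "0 \<le> y" "y \<le> 1"
    have "M \<le> length w div 2" using w by auto
    then have "(2::real) ^ M \<le> 2 ^ (length w div 2)" by (intro power_increasing) auto
    then have q: "2 ^ M \<le> cden w 0" using cden_growth[OF w(1)] by linarith
    have "cden w 0 * 1 \<le> cden w 0 * cden w 0"
      using cden_ge_1[OF w(1), of 0] by (intro mult_left_mono) auto
    then have "2 ^ M \<le> (cden w 0)\<^sup>2" using q by (simp add: power2_eq_square)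
    then have "1 / (cden w 0)\<^sup>2 \<le> 1 / 2 ^ M"
      using cden_pos[OF w(1), of 0] by (intro divide_left_mono mult_pos_pos) auto
    then show "\<bar>cmap w x - cmap w y\<bar> < e"
      using cmap_diff_le[OF w(1) xy] M by (simp add: power_one_over)
  qed
qed

text \<open>All convergents of index at least \<open>N\<close> lie in the cylinder of the first
  \<open>N\<close> digits, so small cylinders give a Cauchy sequence.\<close>

lemma cf_convergent_tendsto:
  assumes "\<And>i. 0 < b i"
  shows "cf_convergent b \<longlonglongrightarrow> cf_value b"
proof -
  have "Cauchy (cf_convergent b)"
  proof (rule CauchyI)
    fix e :: real assume "0 < e"
    then obtain N where N: "\<And>w x y. 0 \<notin> set w \<Longrightarrow> N \<le> length w \<Longrightarrow> 0 \<le> x \<Longrightarrow> x \<le> 1 \<Longrightarrow> 0 \<le> y \<Longrightarrow>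
      y \<le> 1 \<Longrightarrow> \<bar>cmap w x - cmap w y\<bar> < e"
      using cylinder_small by blast
    have w: "0 \<notin> set (map b [0..<N])" using assms by (metis ex_map_conv less_irrefl)
    have s: "0 \<le> cf_convergent (\<lambda>i. b (N + i)) k \<and> cf_convergent (\<lambda>i. b (N + i)) k \<le> 1" for k
      using cf_convergent_unit[of "\<lambda>i. b (N + i)"] assms by auto
    show "\<exists>M. \<forall>m\<ge>M. \<forall>n\<ge>M. norm (cf_convergent b m - cf_convergent b n) < e"
    proof (intro exI[of _ N] allI impI)
      fix m n assume "N \<le> m" "N \<le> n"
      then show "norm (cf_convergent b m - cf_convergent b n) < e"
        using N[OF w, of "cf_convergent (\<lambda>i. b (N + i)) (m - N)" "cf_convergent (\<lambda>i. b (N + i)) (n - N)"]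
          s cf_convergent_add[of b N "m - N"] cf_convergent_add[of b N "n - N"] by simp
    qed
  qed
  then show ?thesis
    by (simp add: Cauchy_convergent_iff convergent_LIMSEQ_iff cf_value_def)
qed

lemma cf_value_Suc:
  assumes "\<And>i. 0 < b i"
  shows "cf_value b = 1 / (real (b 0) + cf_value (\<lambda>i. b (Suc i)))" "0 < cf_value b" "cf_value b < 1"
proof -
  have ge: "0 \<le> cf_value b" if "\<And>i. 0 < b i" for b
    using cf_convergent_tendsto[of b, OF that] cf_convergent_unit(1)[of b, OF that]
    by (intro LIMSEQ_le_const) auto
  have b0: "1 \<le> real (b 0)" using assms[of 0] by simp
  have eq: "cf_value b = 1 / (real (b 0) + cf_value (\<lambda>i. b (Suc i)))"
    if b: "\<And>i. 0 < b i" for b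
  proof (rule LIMSEQ_unique)
    show "(\<lambda>n. cf_convergent b (Suc n)) \<longlonglongrightarrow> cf_value b"
      using cf_convergent_tendsto[of b, OF b] by (intro LIMSEQ_Suc)
    have "real (b 0) + cf_value (\<lambda>i. b (Suc i)) \<noteq> 0"
      using ge[of "\<lambda>i. b (Suc i)"] b b[of 0] by (metis add_nonneg_eq_0_iff of_nat_0_eq_iff of_nat_0_le_iff less_irrefl)
    then show "(\<lambda>n. cf_convergent b (Suc n)) \<longlonglongrightarrow> 1 / (real (b 0) + cf_value (\<lambda>i. b (Suc i)))"
      using cf_convergent_tendsto[of "\<lambda>i. b (Suc i)"] b by (auto intro!: tendsto_intros)
  qed
  have pos: "0 < cf_value b" if b: "\<And>i. 0 < b i" for b
  proof -
    have "0 \<le> cf_value (\<lambda>i. b (Suc i))" by (rule ge) (rule b)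
    then have "0 < real (b 0) + cf_value (\<lambda>i. b (Suc i))" using b[of 0] by (simp add: add_pos_nonneg)
    then show ?thesis by (subst eq[OF b]) simp
  qed
  show *: "cf_value b = 1 / (real (b 0) + cf_value (\<lambda>i. b (Suc i)))"
    by (rule eq) (rule assms)
  show "0 < cf_value b" by (rule pos) (rule assms)
  have "0 < cf_value (\<lambda>i. b (Suc i))" by (rule pos) (rule assms)
  then show "cf_value b < 1" using b0 by (subst *) simp
qed

lemma cf_value_append:
  assumes "\<And>i. 0 < b i"
  shows "cf_value b = cmap (map b [0..<n]) (cf_value (\<lambda>i. b (n + i)))"
  using assms
proof (induction n arbitrary: b)
  case (Suc n)
  have "map b [0..<Suc n] = b 0 # map (\<lambda>i. b (Suc i)) [0..<n]"
    by (rule map_upt_Suc)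
  moreover have "cf_value (\<lambda>i. b (Suc i)) =
    cmap (map (\<lambda>i. b (Suc i)) [0..<n]) (cf_value (\<lambda>i. b (Suc (n + i))))"
    by (rule Suc.IH) (rule Suc.prems)
  ultimately show ?case using cf_value_Suc(1)[of b, OF Suc.prems] by (simp only: cmap.simps add_Suc)
qed simp

lemma cf_set_unit:
  assumes "0 \<notin> A" "x \<in> cf_set A"
  shows "0 < x" "x < 1"
proof -
  obtain b where "x = cf_value b" "\<And>i. b i \<in> A" using assms by (auto simp: cf_set_def)
  moreover from this have "0 < b i" for i using assms by (metis gr0I)
  ultimately show "0 < x" "x < 1" using cf_value_Suc(2,3) by auto
qed

lemma cmap_cf_set:
  assumes "0 \<notin> A" "set w \<subseteq> A" "x \<in> cf_set A"
  shows "cmap w x \<in> cf_set A"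
  using assms(2)
proof (induction w)
  case (Cons c w)
  then obtain b where b: "cmap w x = cf_value b" "\<And>i. b i \<in> A" by (auto simp: cf_set_def)
  define b' where "b' = case_nat c b"
  have b': "b' i \<in> A" for i using b Cons.prems by (auto simp: b'_def split: nat.split)
  then have "0 < b' i" for i using assms(1) by (metis gr0I)
  then have "cf_value b' = 1 / (real (b' 0) + cf_value (\<lambda>i. b' (Suc i)))" by (rule cf_value_Suc)
  then have "cmap (c # w) x = cf_value b'" using b by (simp add: b'_def)
  then show ?case using b' by (auto simp: cf_set_def)
qed (use assms in auto)

lemma cf_set_eq_words:
  assumes "0 \<notin> A"
  shows "cf_set A = (\<Union>w\<in>words A n. cmap w ` cf_set A)"
proof
  show "cf_set A \<subseteq> (\<Union>w\<in>words A n. cmap w ` cf_set A)"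
  proof
    fix x assume "x \<in> cf_set A"
    then obtain b where b: "x = cf_value b" "\<And>i. b i \<in> A" by (auto simp: cf_set_def)
    then have "0 < b i" for i using assms by (metis gr0I)
    then have "x = cmap (map b [0..<n]) (cf_value (\<lambda>i. b (n + i)))" using b cf_value_append by auto
    moreover have "map b [0..<n] \<in> words A n" using b by (auto simp: words_def)
    moreover have "cf_value (\<lambda>i. b (n + i)) \<in> cf_set A" using b by (auto simp: cf_set_def)
    ultimately show "x \<in> (\<Union>w\<in>words A n. cmap w ` cf_set A)" by blast
  qed
qed (use assms cmap_cf_set in \<open>auto simp: words_def\<close>)

lemma cf_set_mono: "A \<subseteq> B \<Longrightarrow> cf_set A \<subseteq> cf_set B"
  by (auto simp: cf_set_def)

lemma cf_set_empty [simp]: "cf_set {} = {}"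
  by (auto simp: cf_set_def)

lemma cf_set_nonempty: "A \<noteq> {} \<Longrightarrow> cf_set A \<noteq> {}"
  by (auto simp: cf_set_def)


section \<open>Upper bounds for the dimension\<close>

lemma hausdorff_measure_eq_0I:
  assumes "\<And>\<delta> e::real. 0 < \<delta> \<Longrightarrow> 0 < e \<Longrightarrow> \<exists>U\<in>delta_covers \<delta> E. (\<Sum>i. diam_pow s (U i)) \<le> ennreal e"
  shows "hausdorff_measure s E = 0"
proof -
  have "hausdorff_premeasure s \<delta> E = 0" if "0 < \<delta>" for \<delta>
  proof -
    have *: "hausdorff_premeasure s \<delta> E \<le> 0 + ennreal e" if "0 < e" for e
      using assms[OF \<open>0 < \<delta>\<close> that] unfolding hausdorff_premeasure_def
      by (auto intro: INF_lower2)
    have "hausdorff_premeasure s \<delta> E \<le> 0" by (rule ennreal_le_epsilon) (rule *)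
    then show ?thesis by simp
  qed
  then show ?thesis by (simp add: hausdorff_measure_def)
qed

lemma hausdorff_dim_le:
  assumes "0 \<le> s" "hausdorff_measure s E = 0"
  shows "hausdorff_dim E \<le> s"
  unfolding hausdorff_dim_def using assms by (intro cInf_lower) (auto intro: bdd_belowI[of _ 0])

text \<open>Exhibits an exponent of measure zero. Since \<open>hausdorff_dim\<close> is an infimum
  of reals, lower bounds on it require the set of such exponents to be nonempty.\<close>

lemma hausdorff_measure_2_unit:
  fixes E :: "real set"
  assumes "E \<subseteq> {0..1}"
  shows "hausdorff_measure 2 E = 0"
proof (rule hausdorff_measure_eq_0I)
  fix \<delta> e :: real assume "0 < \<delta>" "0 < e"
  obtain n :: nat where n: "1 / \<delta> + 2 / e + 1 < real n" using reals_Archimedean2 by blast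
  have "1 / \<delta> > 0" "2 / e > 0" using \<open>0 < \<delta>\<close> \<open>0 < e\<close> by auto
  then have n1: "1 / \<delta> < real n" "2 / e < real n" "1 < real n" using n by linarith+
  \<comment> \<open>The floor of \<open>n * x\<close> reaches the index \<open>n\<close> at
    \<open>x = 1\<close>, hence \<open>n + 1\<close> intervals.\<close>
  define U where "U i = (if i \<le> n then {real i / n..(real i + 1) / n} else {})" for i
  have d: "diameter (U i) = (if i \<le> n then 1 / n else 0)" for i
    using n1 by (auto simp: U_def field_simps)
  have "U \<in> delta_covers \<delta> E"
    unfolding delta_covers_def
  proof (intro CollectI conjI allI)
    show "bounded (U i)" for i by (auto simp: U_def)
    have "1 / n \<le> \<delta>" using n1 \<open>0 < \<delta>\<close> by (simp add: field_simps)
    then show "diameter (U i) \<le> \<delta>" for i using d \<open>0 < \<delta>\<close> by auto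
    show "E \<subseteq> (\<Union>i. U i)"
    proof
      fix x assume "x \<in> E"
      then have x: "0 \<le> x" "x \<le> 1" using assms by auto
      define i where "i = nat \<lfloor>real n * x\<rfloor>"
      have nx: "0 \<le> real n * x" "real n * x \<le> real n" using x by (auto simp: mult_left_le)
      have i: "real i \<le> real n * x" "real n * x < real i + 1"
        using nx unfolding i_def by linarith+
      then have "i \<le> n" using nx by linarith
      then have "x \<in> U i" using i n1 by (auto simp: U_def field_simps)
      then show "x \<in> (\<Union>i. U i)" by blast
    qed
  qed
  moreover have "(\<Sum>i. diam_pow 2 (U i)) \<le> ennreal e"
  proof -
    have "(\<Sum>i. diam_pow 2 (U i)) = (\<Sum>i\<le>n. diam_pow 2 (U i))"
      by (intro suminf_finite) (auto simp: diam_pow_def U_def)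
    also have "\<dots> \<le> (\<Sum>i\<le>n. ennreal ((1 / n)\<^sup>2))"
      using n1 by (intro sum_mono) (auto simp: diam_pow_def d)
    also have "\<dots> = ennreal (\<Sum>i\<le>n. (1 / n)\<^sup>2)" by (subst sum_ennreal) auto
    also have "(\<Sum>i\<le>n. (1 / real n)\<^sup>2) \<le> e"
    proof -
      have "(\<Sum>i\<le>n. (1 / real n)\<^sup>2) = (real n + 1) / (real n * real n)"
        by (simp add: power2_eq_square)
      also have "\<dots> \<le> (2 * real n) / (real n * real n)"
        using n1 by (intro divide_right_mono) auto
      also have "\<dots> = 2 / real n" using n1 by simp
      also have "\<dots> \<le> e" using n1 \<open>0 < e\<close> by (simp add: field_simps)
      finally show ?thesis .
    qed
    finally show ?thesis by (simp add: ennreal_leI)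
  qed
  ultimately show "\<exists>U\<in>delta_covers \<delta> E. (\<Sum>i. diam_pow 2 (U i)) \<le> ennreal e" by blast
qed

lemma hausdorff_dim_ge:
  fixes E :: "real set"
  assumes "E \<subseteq> {0..1}" "\<And>r. 0 \<le> r \<Longrightarrow> hausdorff_measure r E = 0 \<Longrightarrow> s \<le> r"
  shows "s \<le> hausdorff_dim E"
  unfolding hausdorff_dim_def using assms hausdorff_measure_2_unit[of E]
  by (intro cInf_greatest) (auto intro: exI[of _ 2])

lemma hausdorff_measure_mono:
  assumes "E \<subseteq> E'"
  shows "hausdorff_measure s E \<le> hausdorff_measure s E'"
  unfolding hausdorff_measure_def hausdorff_premeasure_def
  using assms by (intro SUP_mono' INF_superset_mono) (auto simp: delta_covers_def)

lemma hausdorff_dim_mono: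
  fixes E E' :: "real set"
  assumes "E \<subseteq> E'" "E' \<subseteq> {0..1}"
  shows "hausdorff_dim E \<le> hausdorff_dim E'"
proof (rule hausdorff_dim_ge[OF assms(2)])
  fix r :: real assume "0 \<le> r" "hausdorff_measure r E' = 0"
  then show "hausdorff_dim E \<le> r"
    using hausdorff_measure_mono[OF assms(1), of r] by (intro hausdorff_dim_le) auto
qed

lemma cf_set_subset_unit: "0 \<notin> A \<Longrightarrow> cf_set A \<subseteq> {0..1}"
  by (rule subsetI) (simp add: cf_set_unit less_imp_le)

lemma cf_dim_mono:
  "A \<subseteq> B \<Longrightarrow> 0 \<notin> B \<Longrightarrow> hausdorff_dim (cf_set A) \<le> hausdorff_dim (cf_set B)"
  by (intro hausdorff_dim_mono cf_set_mono cf_set_subset_unit)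

lemma cf_dim_nonneg: "0 \<notin> A \<Longrightarrow> 0 \<le> hausdorff_dim (cf_set A)"
  by (intro hausdorff_dim_ge cf_set_subset_unit)

lemma cf_dim_le_2: "0 \<notin> A \<Longrightarrow> hausdorff_dim (cf_set A) \<le> 2"
  by (intro hausdorff_dim_le hausdorff_measure_2_unit cf_set_subset_unit) auto

section \<open>Covering by cylinders\<close>

lemma cylinder_diameter:
  assumes "0 \<notin> set w" "E \<subseteq> {0..1}"
  shows "bounded (cmap w ` E)" "diameter (cmap w ` E) \<le> 1 / (cden w 0)\<^sup>2"
proof -
  have "cmap w ` E \<subseteq> {0..1}"
    using assms cmap_nonneg[of _ w] cmap_le_1[of w] by (auto simp: subset_iff)
  then show "bounded (cmap w ` E)" using bounded_subset bounded_closed_interval by blast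
  show "diameter (cmap w ` E) \<le> 1 / (cden w 0)\<^sup>2"
    using assms cmap_diff_le[of w] by (intro diameter_le) (auto simp: subset_iff)
qed

lemma diam_pow_cylinder:
  assumes "0 \<notin> set w" "E \<subseteq> {0..1}" "0 \<le> s"
  shows "diam_pow s (cmap w ` E) \<le> ennreal (cden w 0 powr (-2 * s))"
proof -
  have p: "0 < cden w 0" using cden_pos assms by auto
  have "diameter (cmap w ` E) powr s \<le> (cden w 0 powr (-2)) powr s"
    using cylinder_diameter[OF assms(1,2)] assms(3) p
    by (intro powr_mono2) (auto simp: powr_minus_divide diameter_ge_0)
  then show ?thesis using p by (auto simp: diam_pow_def powr_powr intro!: ennreal_leI)
qed

lemma cf_dim_le_of_word_sum:
  assumes A: "0 \<notin> A" and s: "0 \<le> s" and Z: "word_sum A s k < 1"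
  shows "hausdorff_dim (cf_set A) \<le> s"
proof (rule hausdorff_dim_le[OF s], rule hausdorff_measure_eq_0I)
  fix \<delta> e :: real assume "0 < \<delta>" "0 < e"
  have k: "0 < k" using Z by (cases k) auto
  obtain z where z: "word_sum A s k = ennreal z" "0 \<le> z" "z < 1"
    using Z by (cases "word_sum A s k") (auto simp: ennreal_less_one_iff)
  obtain N where N: "z ^ N < e" using real_arch_pow_inv[of e z] \<open>0 < e\<close> z by auto
  obtain M where M: "\<And>w x y. 0 \<notin> set w \<Longrightarrow> M \<le> length w \<Longrightarrow> 0 \<le> x \<Longrightarrow> x \<le> 1 \<Longrightarrow> 0 \<le> y \<Longrightarrow> y \<le> 1 \<Longrightarrow>
    \<bar>cmap w x - cmap w y\<bar> < \<delta>"
    using cylinder_small[OF \<open>0 < \<delta>\<close>] by blast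
  \<comment> \<open>A multiple of \<open>k\<close>, as \<open>word_sum_mult_le_power\<close> asks
    for. The summand \<open>M\<close> makes the cylinders shorter than \<open>\<delta>\<close>, the
    summand \<open>N\<close> makes their sum smaller than \<open>e\<close>.\<close>
  define n where "n = (M + N) * k"
  have n: "M \<le> n" using k by (simp add: n_def algebra_simps trans_le_add1)
  \<comment> \<open>Covers are indexed by natural numbers, so all lists are enumerated and those
    outside \<open>words A n\<close> contribute the empty set.\<close>
  let ?W = "from_nat_into (UNIV :: nat list set)"
  define U where "U i = (if ?W i \<in> words A n then cmap (?W i) ` cf_set A else {})" for i
  have bij: "bij_betw ?W UNIV UNIV"
    by (rule bij_betw_from_nat_into) (auto simp: infinite_UNIV_listI)
  have J: "cf_set A \<subseteq> {0..1}" using A by (rule cf_set_subset_unit)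
  have "U \<in> delta_covers \<delta> (cf_set A)"
    unfolding delta_covers_def
  proof (intro CollectI conjI allI)
    fix i
    have *: "diameter (cmap w ` cf_set A) \<le> \<delta>" if "w \<in> words A n" for w
    proof (rule diameter_le)
      have w: "0 \<notin> set w" "M \<le> length w" using that n words_pos[OF A that] by (auto simp: words_def)
      show "norm (x - y) \<le> \<delta>" if "x \<in> cmap w ` cf_set A" "y \<in> cmap w ` cf_set A" for x y
        using that M[OF w] J by (force simp: subset_iff intro!: less_imp_le)
    qed (use \<open>0 < \<delta>\<close> in auto)
    then show "diameter (U i) \<le> \<delta>" using \<open>0 < \<delta>\<close> by (simp add: U_def)
    show "bounded (U i)"
      using cylinder_diameter(1)[OF _ J] words_pos[OF A] by (auto simp: U_def)
  next
    show "cf_set A \<subseteq> (\<Union>i. U i)"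
    proof
      fix x assume "x \<in> cf_set A"
      then obtain w where w: "w \<in> words A n" "x \<in> cmap w ` cf_set A"
        using cf_set_eq_words[OF A, of n] by blast
      obtain i where "?W i = w" using bij by (metis bij_betw_imp_surj_on UNIV_I imageE)
      then have "x \<in> U i" using w by (simp add: U_def)
      then show "x \<in> (\<Union>i. U i)" by blast
    qed
  qed
  moreover have "(\<Sum>i. diam_pow s (U i)) \<le> ennreal e"
  proof -
    let ?g = "\<lambda>w. ennreal (cden w 0 powr (-2 * s)) * indicator (words A n) w"
    have "(\<Sum>i. diam_pow s (U i)) = (\<integral>\<^sup>+i. diam_pow s (U i) \<partial>count_space UNIV)"
      by (rule nn_integral_count_space_nat[symmetric])
    also have "\<dots> \<le> (\<integral>\<^sup>+i. ?g (?W i) \<partial>count_space UNIV)"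
    proof (rule nn_integral_mono)
      fix i
      show "diam_pow s (U i) \<le> ?g (?W i)"
        using diam_pow_cylinder[OF _ J s] words_pos[OF A]
        by (cases "?W i \<in> words A n") (auto simp: U_def diam_pow_def[of _ "{}"])
    qed
    also have "\<dots> = (\<integral>\<^sup>+w. ?g w \<partial>count_space UNIV)"
      by (rule nn_integral_bij_count_space[OF bij])
    also have "\<dots> = word_sum A s n"
      unfolding word_sum_def by (subst nn_integral_count_space_indicator) auto
    also have "\<dots> \<le> word_sum A s k ^ (M + N)" unfolding n_def by (rule word_sum_mult_le_power[OF A s])
    also have "\<dots> = ennreal (z ^ (M + N))" using z by (simp add: ennreal_power)
    also have "z ^ (M + N) \<le> z ^ N" using z by (intro power_decreasing) auto
    also have "\<dots> \<le> e" using N by simp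
    finally show ?thesis by (simp add: ennreal_leI)
  qed
  ultimately show "\<exists>U\<in>delta_covers \<delta> (cf_set A). (\<Sum>i. diam_pow s (U i)) \<le> ennreal e" by blast
qed

section \<open>Lower bounds for the dimension\<close>

text \<open>
  A cylinder without finite subcover always contains a child without finite subcover; the resulting
  branch ends in a point that no member of the cover can contain.
\<close>
lemma compact_cf_set:
  assumes F: "finite F" "0 \<notin> F"
  shows "compact (cf_set F)"
  unfolding compact_eq_Heine_Borel
proof (intro allI impI, elim conjE)
  fix C :: "real set set"
  assume C: "\<forall>c\<in>C. open c" "cf_set F \<subseteq> \<Union>C"
  define good where "good w \<longleftrightarrow> (\<exists>D\<subseteq>C. finite D \<and> cmap w ` cf_set F \<subseteq> \<Union>D)" for w
  have step: "\<exists>c\<in>F. \<not> good (w @ [c])" if "\<not> good w" for w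
  proof (rule ccontr)
    assume "\<not> (\<exists>c\<in>F. \<not> good (w @ [c]))"
    then have "\<forall>c\<in>F. \<exists>D\<subseteq>C. finite D \<and> cmap (w @ [c]) ` cf_set F \<subseteq> \<Union>D"
      unfolding good_def by blast
    then obtain D where D: "\<And>c. c \<in> F \<Longrightarrow> D c \<subseteq> C \<and> finite (D c) \<and> cmap (w @ [c]) ` cf_set F \<subseteq> \<Union>(D c)"
      by metis
    have "cmap w ` cf_set F \<subseteq> \<Union>(\<Union>c\<in>F. D c)"
    proof (rule image_subsetI)
      fix x assume "x \<in> cf_set F"
      then obtain v y where v: "v \<in> words F 1" "x = cmap v y" "y \<in> cf_set F"
        using cf_set_eq_words[OF F(2), of 1] by blast
      then obtain c where "v = [c]" "c \<in> F" by (auto simp: words_def length_Suc_conv)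
      then have "cmap w x \<in> cmap (w @ [c]) ` cf_set F" using v by (simp add: cmap_append)
      then show "cmap w x \<in> \<Union>(\<Union>c\<in>F. D c)" using D[OF \<open>c \<in> F\<close>] \<open>c \<in> F\<close> by blast
    qed
    moreover have "(\<Union>c\<in>F. D c) \<subseteq> C" "finite (\<Union>c\<in>F. D c)" using D F by auto
    ultimately have "good w" unfolding good_def by blast
    then show False using that by simp
  qed
  have "good []"
  proof (rule ccontr)
    assume bad: "\<not> good []"
    have "\<exists>f. \<forall>n. (length (f n) = n \<and> set (f n) \<subseteq> F \<and> \<not> good (f n)) \<and> (\<exists>c. f (Suc n) = f n @ [c])"
    proof (rule dependent_nat_choice)
      show "\<exists>w. length w = 0 \<and> set w \<subseteq> F \<and> \<not> good w" using bad by auto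
    next
      fix w n assume w: "length w = n \<and> set w \<subseteq> F \<and> \<not> good w"
      then obtain c where "c \<in> F" "\<not> good (w @ [c])" using step by blast
      then show "\<exists>v. (length v = Suc n \<and> set v \<subseteq> F \<and> \<not> good v) \<and> (\<exists>c. v = w @ [c])"
        using w by (intro exI[of _ "w @ [c]"]) auto
    qed
    then obtain f where f: "\<And>n. length (f n) = n" "\<And>n. set (f n) \<subseteq> F" "\<And>n. \<not> good (f n)"
      "\<And>n. \<exists>c. f (Suc n) = f n @ [c]" by blast
    define b where "b n = last (f (Suc n))" for n
    have fb: "f n = map b [0..<n]" for n
    proof (induction n)
      case (Suc n)
      obtain c where "f (Suc n) = f n @ [c]" using f(4) by blast
      then show ?case using Suc by (simp add: b_def)
    qed (use f(1)[of 0] in simp)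
    have bF: "b n \<in> F" for n
    proof -
      have "last (f (Suc n)) \<in> set (f (Suc n))"
        using f(1)[of "Suc n"] by (intro last_in_set) auto
      then show ?thesis using f(2)[of "Suc n"] by (auto simp: b_def)
    qed
    have b0: "0 < b n" for n using bF F(2) by (metis gr0I)
    have "cf_value b \<in> cf_set F" using bF by (auto simp: cf_set_def)
    then obtain U where U: "U \<in> C" "cf_value b \<in> U" using C by blast
    then obtain e where e: "0 < e" "ball (cf_value b) e \<subseteq> U" using C(1) open_contains_ball by blast
    obtain N where N: "\<And>w x y. 0 \<notin> set w \<Longrightarrow> N \<le> length w \<Longrightarrow> 0 \<le> x \<Longrightarrow> x \<le> 1 \<Longrightarrow> 0 \<le> y \<Longrightarrow>
      y \<le> 1 \<Longrightarrow> \<bar>cmap w x - cmap w y\<bar> < e"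
      using cylinder_small[OF e(1)] by blast
    have w: "0 \<notin> set (f N)" "N \<le> length (f N)" using f(1,2)[of N] F by auto
    define t where "t = cf_value (\<lambda>i. b (N + i))"
    have t: "t \<in> cf_set F" using bF by (auto simp: cf_set_def t_def)
    have bt: "cf_value b = cmap (f N) t" unfolding fb t_def by (rule cf_value_append[OF b0])
    have "cmap (f N) ` cf_set F \<subseteq> ball (cf_value b) e"
    proof (rule image_subsetI)
      fix x assume "x \<in> cf_set F"
      then show "cmap (f N) x \<in> ball (cf_value b) e"
        using N[OF w, of t x] cf_set_unit[OF F(2), of x] cf_set_unit[OF F(2) t]
        by (simp add: bt dist_real_def)
    qed
    then have "cmap (f N) ` cf_set F \<subseteq> \<Union>{U}" using e by auto
    then have "good (f N)" unfolding good_def using U(1)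
      by (intro exI[of _ "{U}"]) auto
    then show False using f(3) by blast
  qed
  then show "\<exists>D\<subseteq>C. finite D \<and> cf_set F \<subseteq> \<Union>D" by (simp add: good_def)
qed

text \<open>
  If no member of the cover has diameter at least \<open>d\<close>, then each meets a single piece \<open>\<psi> w ` K\<close>, so
  that pulling back gives for every \<open>w\<close> a cover of \<open>K\<close> by fewer sets.
\<close>
lemma self_similar_cover_sum:
  fixes K :: "'a::real_normed_vector set" and \<psi> :: "'w \<Rightarrow> 'a \<Rightarrow> 'a" and I :: "'i set"
  assumes W: "finite W" "w1 \<in> W" "w2 \<in> W" "w1 \<noteq> w2"
    and K: "K \<noteq> {}" "bounded K" "\<And>w. w \<in> W \<Longrightarrow> \<psi> w ` K \<subseteq> K"
    and c: "\<And>w. w \<in> W \<Longrightarrow> 0 < c w"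
    and lower: "\<And>w x y. w \<in> W \<Longrightarrow> x \<in> K \<Longrightarrow> y \<in> K \<Longrightarrow> c w * dist x y \<le> dist (\<psi> w x) (\<psi> w y)"
    and sep: "\<And>v w x y. v \<in> W \<Longrightarrow> w \<in> W \<Longrightarrow> v \<noteq> w \<Longrightarrow> x \<in> K \<Longrightarrow> y \<in> K \<Longrightarrow>
      d \<le> dist (\<psi> v x) (\<psi> w y)"
    and s: "0 < s" "1 \<le> (\<Sum>w\<in>W. c w powr s)"
    and d: "0 < d"
    and U: "finite I" "\<And>i. i \<in> I \<Longrightarrow> bounded (U i)" "K \<subseteq> (\<Union>i\<in>I. U i)"
  shows "d powr s \<le> (\<Sum>i\<in>I. diameter (U i) powr s)"
  using U
proof (induction "card I" arbitrary: I U rule: less_induct)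
  case less
  show ?case
  proof (cases "\<exists>i\<in>I. d \<le> diameter (U i)")
    case True
    then obtain i where i: "i \<in> I" "d \<le> diameter (U i)" by blast
    then have "d powr s \<le> diameter (U i) powr s" using d s by (intro powr_mono2) auto
    also have "\<dots> \<le> (\<Sum>i\<in>I. diameter (U i) powr s)" using i less.prems by (intro member_le_sum) auto
    finally show ?thesis .
  next
    case False
    define J where "J w = {i \<in> I. U i \<inter> \<psi> w ` K \<noteq> {}}" for w
    have JI: "J w \<subseteq> I" for w by (auto simp: J_def)
    have disj: "J v \<inter> J w = {}" if vw: "v \<in> W" "w \<in> W" "v \<noteq> w" for v w
    proof (rule ccontr)
      assume "J v \<inter> J w \<noteq> {}"
      then obtain i x y where i: "i \<in> I" "x \<in> K" "y \<in> K" "\<psi> v x \<in> U i" "\<psi> w y \<in> U i"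
        by (auto simp: J_def)
      then have "d \<le> diameter (U i)"
        using sep[OF vw i(2,3)] diameter_bounded_bound[OF less.prems(2)[OF i(1)] i(4,5)] by linarith
      then show False using False i by blast
    qed
    have J_ne: "J w \<noteq> {}" if w: "w \<in> W" for w
    proof -
      obtain x where "x \<in> K" using K by blast
      then have "\<psi> w x \<in> K" using K(3)[OF w] by blast
      then obtain i where "i \<in> I" "\<psi> w x \<in> U i" using less.prems by blast
      then show ?thesis using \<open>x \<in> K\<close> by (auto simp: J_def)
    qed
    have piece: "c w powr s * d powr s \<le> (\<Sum>i\<in>J w. diameter (U i) powr s)" if w: "w \<in> W" for w
    proof -
      \<comment> \<open>A second piece makes the induction go down: \<open>J v\<close> is nonempty
        and disjoint from \<open>J w\<close>, so \<open>J w\<close> is a proper subset of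
        \<open>I\<close>.\<close>
      obtain v where v: "v \<in> W" "v \<noteq> w" using W by metis
      have "J w \<noteq> I" using disj[OF v(1) w v(2)] J_ne[OF v(1)] JI[of v] by blast
      then have card: "card (J w) < card I" using JI less.prems(1) by (metis psubsetI psubset_card_mono)
      define V where "V i = K \<inter> \<psi> w -` U i" for i
      have Vb: "bounded (V i)" for i unfolding V_def using K(2) by (rule bounded_Int[OF disjI1])
      have "K \<subseteq> (\<Union>i\<in>J w. V i)"
      proof
        fix x assume x: "x \<in> K"
        then have "\<psi> w x \<in> K" using K(3)[OF w] by blast
        then obtain i where "i \<in> I" "\<psi> w x \<in> U i" using less.prems by blast
        then show "x \<in> (\<Union>i\<in>J w. V i)" using x by (auto simp: J_def V_def)
      qed
      then have "d powr s \<le> (\<Sum>i\<in>J w. diameter (V i) powr s)"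
        using less.hyps[OF card] finite_subset[OF JI less.prems(1)] Vb by blast
      also have "\<dots> \<le> (\<Sum>i\<in>J w. (diameter (U i) / c w) powr s)"
      proof (intro sum_mono powr_mono2)
        fix i assume i: "i \<in> J w"
        show "0 \<le> diameter (V i)" using Vb by (rule diameter_ge_0)
        have Ub: "bounded (U i)" using i JI less.prems by blast
        show "diameter (V i) \<le> diameter (U i) / c w"
        proof (rule diameter_le)
          show "V i \<noteq> {} \<or> 0 \<le> diameter (U i) / c w" using diameter_ge_0[OF Ub] c[OF w] by simp
          fix x y assume "x \<in> V i" "y \<in> V i"
          then have "c w * dist x y \<le> diameter (U i)"
            using lower[OF w, of x y] diameter_bounded_bound[OF Ub, of "\<psi> w x" "\<psi> w y"]
            by (auto simp: V_def)
          then show "norm (x - y) \<le> diameter (U i) / c w"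
            using c[OF w] by (simp add: dist_norm field_simps)
        qed
      qed (use s in auto)
      also have "\<dots> = (\<Sum>i\<in>J w. diameter (U i) powr s) / c w powr s"
        unfolding sum_divide_distrib
        by (intro sum.cong refl powr_divide)
      finally show ?thesis using c[OF w] by (simp add: field_simps)
    qed
    have "d powr s \<le> (\<Sum>w\<in>W. c w powr s) * d powr s"
      using s(2) by (simp add: mult_le_cancel_right1)
    also have "\<dots> = (\<Sum>w\<in>W. c w powr s * d powr s)" by (rule sum_distrib_right)
    also have "\<dots> \<le> (\<Sum>w\<in>W. \<Sum>i\<in>J w. diameter (U i) powr s)" by (intro sum_mono piece)
    also have "\<dots> = (\<Sum>i\<in>(\<Union>w\<in>W. J w). diameter (U i) powr s)"
      using W(1) disj finite_subset[OF JI less.prems(1)] by (intro sum.UNION_disjoint[symmetric]) auto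
    also have "\<dots> \<le> (\<Sum>i\<in>I. diameter (U i) powr s)"
      using less.prems(1) JI by (intro sum_mono2) auto
    finally show ?thesis .
  qed
qed

text \<open>Continuity of \<open>x powr s\<close> on \<open>{0..}\<close>, which at 0 relies on
  \<open>0 < s\<close>, makes the cost of opening a member of a cover arbitrarily small, also when
  its diameter is 0.\<close>

lemma open_enlargement:
  fixes U :: "'a::real_normed_vector set"
  assumes "bounded U" "0 < s" "0 < e"
  shows "\<exists>V. open V \<and> U \<subseteq> V \<and> bounded V \<and> diameter V powr s \<le> diameter U powr s + e"
proof -
  let ?D = "diameter U"
  have D: "0 \<le> ?D" using assms(1) by (rule diameter_ge_0)
  have "continuous_on {0..} (\<lambda>x::real. x powr s)"
    using assms(2) by (intro continuous_on_powr' continuous_intros) auto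
  then have "\<exists>\<delta>>0. \<forall>x\<in>{0..}. dist x ?D < \<delta> \<longrightarrow> dist (x powr s) (?D powr s) < e"
    using D assms(3) unfolding continuous_on_iff by simp
  then obtain \<delta> where \<delta>: "0 < \<delta>" "\<And>x. 0 \<le> x \<Longrightarrow> \<bar>x - ?D\<bar> < \<delta> \<Longrightarrow> \<bar>x powr s - ?D powr s\<bar> < e"
    unfolding dist_real_def by auto
  \<comment> \<open>Radius \<open>\<delta> / 4\<close> enlarges the diameter by at most
    \<open>\<delta> / 2\<close>, which is strictly inside the range allowed by continuity.\<close>
  define V where "V = (\<Union>x\<in>U. ball x (\<delta> / 4))"
  have VD: "norm (x - y) \<le> ?D + \<delta> / 2" if "x \<in> V" "y \<in> V" for x y
  proof -
    obtain a b where ab: "a \<in> U" "b \<in> U" "dist a x < \<delta> / 4" "dist b y < \<delta> / 4"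
      using \<open>x \<in> V\<close> \<open>y \<in> V\<close> by (auto simp: V_def)
    have "dist x y \<le> dist a x + dist a b + dist b y"
      using dist_triangle[of x y a] dist_triangle[of a y b] by (simp add: dist_commute)
    moreover have "dist a b \<le> ?D" using diameter_bounded_bound[OF assms(1)] ab by blast
    ultimately show ?thesis using ab by (simp add: dist_norm)
  qed
  have bV: "bounded V"
  proof (cases "V = {}")
    case False
    then obtain x where "x \<in> V" by blast
    then show ?thesis using VD[of x] unfolding bounded_def by (auto simp: dist_norm)
  qed auto
  have "diameter V \<le> ?D + \<delta> / 2" using VD D \<delta>(1) by (intro diameter_le) auto
  then have "diameter V powr s \<le> (?D + \<delta> / 2) powr s"
    using assms diameter_ge_0[OF bV] by (intro powr_mono2) auto
  also have "\<dots> \<le> ?D powr s + e" using \<delta>(2)[of "?D + \<delta> / 2"] \<delta>(1) D by auto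
  finally have "diameter V powr s \<le> ?D powr s + e" .
  moreover have "open V" "U \<subseteq> V" using \<delta>(1) by (auto simp: V_def)
  ultimately show ?thesis using bV by blast
qed

text \<open>Compactness reduces countable covers to finite ones: the members are opened at costs
  \<open>e * (1 / 2) ^ Suc i\<close>, which add up to at most \<open>e\<close>.\<close>

lemma hausdorff_premeasure_ge:
  fixes K :: "'a::real_normed_vector set"
  assumes K: "compact K" and s: "0 < s"
    and C: "\<And>(I :: nat set) U. finite I \<Longrightarrow> (\<And>i. i \<in> I \<Longrightarrow> bounded (U i)) \<Longrightarrow> K \<subseteq> (\<Union>i\<in>I. U i) \<Longrightarrow>
      C \<le> (\<Sum>i\<in>I. diameter (U i) powr s)"
  shows "ennreal C \<le> hausdorff_premeasure s \<delta> K"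
  unfolding hausdorff_premeasure_def
proof (rule INF_greatest)
  fix U :: "nat \<Rightarrow> 'a set" assume "U \<in> delta_covers \<delta> K"
  then have U: "K \<subseteq> (\<Union>i. U i)" "\<And>i. bounded (U i)" by (auto simp: delta_covers_def)
  show "ennreal C \<le> (\<Sum>i. diam_pow s (U i))"
  proof (rule ennreal_le_epsilon)
    fix e :: real assume e: "0 < e"
    have "\<forall>i. \<exists>V. open V \<and> U i \<subseteq> V \<and> bounded V \<and>
        diameter V powr s \<le> diameter (U i) powr s + e * (1 / 2) ^ Suc i"
      using open_enlargement[OF U(2) s] e by simp
    then obtain V where V: "\<And>i. open (V i)" "\<And>i. U i \<subseteq> V i" "\<And>i. bounded (V i)"
        "\<And>i. diameter (V i) powr s \<le> diameter (U i) powr s + e * (1 / 2) ^ Suc i"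
      by metis
    obtain I where I: "finite I" "K \<subseteq> (\<Union>i\<in>I. V i)"
      using compactE_image[OF K, of UNIV V] V(1,2) U(1) by (metis (no_types, lifting) SUP_mono' order_trans)
    have "C \<le> (\<Sum>i\<in>I. diameter (V i) powr s)" using C I V(3) by blast
    also have "\<dots> \<le> (\<Sum>i\<in>I. diameter (U i) powr s + e * (1 / 2) ^ Suc i)" by (intro sum_mono V)
    also have "\<dots> = (\<Sum>i\<in>I. diameter (U i) powr s) + e * (\<Sum>i\<in>I. (1 / 2) ^ Suc i)"
      by (simp add: sum.distrib sum_distrib_left)
    also have "(\<Sum>i\<in>I. (1 / 2) ^ Suc i) \<le> (\<Sum>i. (1 / 2 :: real) ^ Suc i)"
      using I(1) power_half_series by (intro sum_le_suminf) (auto simp: sums_iff)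
    also have "\<dots> = 1" using power_half_series by (simp add: sums_iff)
    finally have "C \<le> (\<Sum>i\<in>I. diameter (U i) powr s) + e" using e by (simp add: mult_left_mono)
    then have "ennreal C \<le> (\<Sum>i\<in>I. ennreal (diameter (U i) powr s)) + ennreal e"
      using e by (simp add: sum_nonneg flip: ennreal_plus)
    also have "(\<Sum>i\<in>I. ennreal (diameter (U i) powr s)) = (\<Sum>i\<in>I. diam_pow s (U i))"
      using s by (intro sum.cong) (auto simp: diam_pow_def)
    also have "\<dots> \<le> (\<Sum>i. diam_pow s (U i))" using I(1) by (intro sum_le_suminf) auto
    finally show "ennreal C \<le> (\<Sum>i. diam_pow s (U i)) + ennreal e" by (simp add: add_right_mono)
  qed
qed

text \<open>For a finite alphabet the pieces are finitely many compact sets, pairwise disjoint by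
  \<open>cmap_inj\<close>, hence at positive distance from each other.\<close>

lemma separated_pieces:
  assumes F: "finite F" "0 \<notin> F"
  obtains d where "0 < d" "\<And>v w x y. v \<in> words F k \<Longrightarrow> w \<in> words F k \<Longrightarrow> v \<noteq> w \<Longrightarrow>
    x \<in> cf_set F \<Longrightarrow> y \<in> cf_set F \<Longrightarrow> d \<le> dist (cmap v x) (cmap w y)"
proof -
  let ?J = "cf_set F"
  have comp: "compact (cmap w ` ?J)" if "w \<in> words F k" for w
  proof (rule compact_continuous_image[OF _ compact_cf_set[OF F]])
    have w: "0 \<notin> set w" using words_pos[OF F(2) that] .
    have "1-lipschitz_on ?J (cmap w)"
    proof (rule lipschitz_onI)
      fix x y assume xy: "x \<in> ?J" "y \<in> ?J"
      then have p: "1 \<le> cden w x" "1 \<le> cden w y" "0 \<le> x" "0 \<le> y"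
        using cf_set_unit[OF F(2)] cden_ge_1[OF w] by (auto simp: less_imp_le)
      then have "1 * 1 \<le> cden w x * cden w y" by (intro mult_mono) auto
      then have "\<bar>x - y\<bar> / (cden w x * cden w y) \<le> \<bar>x - y\<bar> / 1"
        by (intro divide_left_mono) auto
      then show "dist (cmap w x) (cmap w y) \<le> 1 * dist x y"
        using cmap_diff[OF w p(3,4)] by (simp add: dist_real_def)
    qed simp
    then show "continuous_on ?J (cmap w)" by (rule lipschitz_on_continuous_on)
  qed
  let ?P = "{(v, w). v \<in> words F k \<and> w \<in> words F k \<and> v \<noteq> w}"
  have "\<forall>p\<in>?P. \<exists>d>0. \<forall>x\<in>?J. \<forall>y\<in>?J. d \<le> dist (cmap (fst p) x) (cmap (snd p) y)"
  proof
    fix p assume "p \<in> ?P"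
    then obtain v w where p: "p = (v, w)" and vw: "v \<in> words F k" "w \<in> words F k" "v \<noteq> w" by blast
    have "cmap v ` ?J \<inter> cmap w ` ?J = {}"
    proof (rule ccontr)
      assume "cmap v ` ?J \<inter> cmap w ` ?J \<noteq> {}"
      then obtain x y where "x \<in> ?J" "y \<in> ?J" "cmap v x = cmap w y" by auto
      then have "v = w"
        using vw words_pos[OF F(2)] cf_set_unit[OF F(2)]
        by (intro cmap_inj[of x y]) (auto simp: words_def)
      then show False using vw by simp
    qed
    then obtain d where "0 < d" "\<forall>x\<in>cmap v ` ?J. \<forall>y\<in>cmap w ` ?J. d \<le> dist x y"
      using separate_compact_closed[OF comp[OF vw(1)] compact_imp_closed[OF comp[OF vw(2)]]] by blast
    then show "\<exists>d>0. \<forall>x\<in>?J. \<forall>y\<in>?J. d \<le> dist (cmap (fst p) x) (cmap (snd p) y)"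
      by (intro exI[of _ d]) (auto simp: p)
  qed
  from bchoice[OF this] obtain d where
    D: "\<forall>p\<in>?P. 0 < d p \<and> (\<forall>x\<in>?J. \<forall>y\<in>?J. d p \<le> dist (cmap (fst p) x) (cmap (snd p) y))" ..
  have d0: "0 < d p" if "p \<in> ?P" for p
    using bspec[OF D that] ..
  have d: "d (v, w) \<le> dist (cmap v x) (cmap w y)" if "(v, w) \<in> ?P" "x \<in> ?J" "y \<in> ?J" for v w x y
    using bspec[OF D that(1)] that(2,3) unfolding fst_conv snd_conv by blast
  have fin: "finite ?P"
    by (rule finite_subset[of _ "words F k \<times> words F k"]) (auto simp: finite_words[OF F(1)])
  \<comment> \<open>The element 1 keeps \<open>Min\<close> meaningful when there is no pair of
    distinct words.\<close>
  show ?thesis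
  proof (rule that[of "Min (insert 1 (d ` ?P))"])
    show "0 < Min (insert 1 (d ` ?P))" using fin d0 by (subst Min_gr_iff) auto
    fix v w x y
    assume *: "v \<in> words F k" "w \<in> words F k" "v \<noteq> w" "x \<in> ?J" "y \<in> ?J"
    then have "Min (insert 1 (d ` ?P)) \<le> d (v, w)" using fin by (intro Min_le) auto
    also have "\<dots> \<le> dist (cmap v x) (cmap w y)" using * by (intro d) auto
    finally show "Min (insert 1 (d ` ?P)) \<le> dist (cmap v x) (cmap w y)" .
  qed
qed

text \<open>The threshold \<open>4 powr s\<close> pays for distortion: the lower contraction ratio
  of \<open>cmap w\<close> is \<open>1 / (4 * (cden w 0)\<^sup>2)\<close>, and the powers of these
  ratios must sum to at least 1 in \<open>self_similar_cover_sum\<close>.\<close>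

lemma hausdorff_measure_cf_set_nonzero:
  assumes F: "finite F" "0 \<notin> F" and s: "0 < s" and Z: "ennreal (4 powr s) < word_sum F s k"
  shows "hausdorff_measure s (cf_set F) \<noteq> 0"
proof -
  let ?J = "cf_set F"
  define c where "c w = 1 / (4 * (cden w 0)\<^sup>2)" for w
  have q: "1 \<le> cden w 0" if "w \<in> words F k" for w
    using cden_ge_1[OF words_pos[OF F(2) that]] by simp
  have cs: "c w powr s = cden w 0 powr (-2 * s) / 4 powr s" if "w \<in> words F k" for w
  proof -
    have "c w = cden w 0 powr (-2) / 4"
      using q[OF that] by (simp add: c_def powr_minus_divide)
    then show ?thesis by (simp only:) (simp add: powr_divide powr_powr)
  qed
  have "4 powr s < (\<Sum>w\<in>words F k. cden w 0 powr (-2 * s))"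
    using Z by (simp add: word_sum_def nn_integral_count_space_finite finite_words[OF F(1)] ennreal_less_iff)
  then have sum: "1 < (\<Sum>w\<in>words F k. c w powr s)"
    by (simp add: cs sum_divide_distrib[symmetric])
  have c: "0 < c w" "c w \<le> 1" if "w \<in> words F k" for w
  proof -
    have *: "1 \<le> (cden w 0)\<^sup>2" using q[OF that] by (rule one_le_power)
    then have "0 < (cden w 0)\<^sup>2" by linarith
    then show "0 < c w" "c w \<le> 1" using * unfolding c_def by (simp, subst pos_divide_le_eq) auto
  qed
  \<comment> \<open>A single word would contribute at most 1, whereas the sum exceeds 1.\<close>
  obtain w1 w2 where w12: "w1 \<in> words F k" "w2 \<in> words F k" "w1 \<noteq> w2"
  proof (rule ccontr)
    assume no: "\<not> thesis"
    have "(\<Sum>w\<in>words F k. c w powr s) \<le> 1"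
    proof (cases "words F k = {}")
      case False
      then obtain w where w: "w \<in> words F k" by blast
      then have "words F k = {w}" using no that by blast
      then show ?thesis using c[OF w] s powr_mono2[of s "c w" 1] by simp
    qed simp
    then show False using sum by simp
  qed
  have ne: "?J \<noteq> {}"
  proof (rule cf_set_nonempty)
    have "length w1 \<noteq> 0" using w12 by (auto simp: words_def)
    then show "F \<noteq> {}" using w12(1) by (auto simp: words_def)
  qed
  obtain d where d: "0 < d" "\<And>v w x y. v \<in> words F k \<Longrightarrow> w \<in> words F k \<Longrightarrow> v \<noteq> w \<Longrightarrow>
    x \<in> ?J \<Longrightarrow> y \<in> ?J \<Longrightarrow> d \<le> dist (cmap v x) (cmap w y)"
    using separated_pieces[OF F] by blast
  have "ennreal (d powr s) \<le> hausdorff_premeasure s 1 ?J"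
  proof (rule hausdorff_premeasure_ge[OF compact_cf_set[OF F] s])
    fix I :: "nat set" and U
    assume U: "finite I" "\<And>i. i \<in> I \<Longrightarrow> bounded (U i)" "?J \<subseteq> (\<Union>i\<in>I. U i)"
    show "d powr s \<le> (\<Sum>i\<in>I. diameter (U i) powr s)"
    proof (rule self_similar_cover_sum[where W = "words F k" and K = ?J and \<psi> = cmap and c = c])
      show "finite (words F k)" by (rule finite_words[OF F(1)])
      show "bounded ?J" using compact_cf_set[OF F] by (rule compact_imp_bounded)
      show "cmap w ` ?J \<subseteq> ?J" if "w \<in> words F k" for w
        using cmap_cf_set[OF F(2)] that by (auto simp: words_def)
      fix w x y assume w: "w \<in> words F k" and "x \<in> ?J" "y \<in> ?J"
      then show "c w * dist x y \<le> dist (cmap w x) (cmap w y)"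
        using cmap_diff_ge[OF words_pos[OF F(2) w], of x y] cf_set_unit[OF F(2)]
        by (simp add: c_def dist_real_def less_imp_le)
    qed (use w12 ne c sum s d U in auto)
  qed
  also have "\<dots> \<le> hausdorff_measure s ?J"
    unfolding hausdorff_measure_def by (rule SUP_upper) simp
  finally show ?thesis using d(1) by (auto simp: ennreal_eq_0_iff)
qed

lemma hausdorff_measure_empty: "hausdorff_measure s {} = 0"
  by (rule hausdorff_measure_eq_0I)
     (auto simp: delta_covers_def diam_pow_def intro!: exI[of _ "\<lambda>_. {}"])

text \<open>Treats the exponent 0, which \<open>hausdorff_measure_cf_set_nonzero\<close> excludes. A
  nonempty member of a cover counts 1 there.\<close>

lemma hausdorff_measure_0_nonzero:
  assumes "E \<noteq> {}"
  shows "hausdorff_measure 0 E \<noteq> 0"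
proof -
  have "1 \<le> hausdorff_premeasure 0 1 E"
    unfolding hausdorff_premeasure_def
  proof (rule INF_greatest)
    fix U assume "U \<in> delta_covers 1 E"
    then obtain i where "U i \<noteq> {}" using assms by (fastforce simp: delta_covers_def)
    then have "1 = (\<Sum>i\<in>{i}. diam_pow 0 (U i))" by (simp add: diam_pow_def)
    also have "\<dots> \<le> (\<Sum>i. diam_pow 0 (U i))" by (intro sum_le_suminf) auto
    finally show "1 \<le> (\<Sum>i. diam_pow 0 (U i))" .
  qed
  also have "\<dots> \<le> hausdorff_measure 0 E"
    unfolding hausdorff_measure_def by (rule SUP_upper) simp
  finally show ?thesis by auto
qed

section \<open>Change of exponent and passage to infinite alphabets\<close>

lemma word_sum_antimono:
  assumes "0 \<notin> A" "r \<le> s"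
  shows "word_sum A s k \<le> word_sum A r k"
  unfolding word_sum_def
proof (rule nn_integral_mono)
  fix w assume "w \<in> space (count_space (words A k))"
  then have "1 \<le> cden w 0" using cden_ge_1[OF words_pos[OF assms(1)]] by simp
  then show "ennreal (cden w 0 powr (-2 * s)) \<le> ennreal (cden w 0 powr (-2 * r))"
    using assms(2) by (intro ennreal_leI powr_mono) auto
qed

text \<open>The criterion is inherited by every smaller exponent: lowering it decreases
  \<open>4 powr s\<close> and increases the word sum.\<close>

lemma cf_dim_ge_of_word_sum:
  assumes F: "finite F" "0 \<notin> F" and s: "0 < s" and Z: "ennreal (4 powr s) < word_sum F s k"
  shows "s \<le> hausdorff_dim (cf_set F)"
proof (rule hausdorff_dim_ge[OF cf_set_subset_unit[OF F(2)]], rule ccontr)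
  fix r :: real assume r: "0 \<le> r" "hausdorff_measure r (cf_set F) = 0" "\<not> s \<le> r"
  have "cf_set F \<noteq> {}"
  proof
    assume "cf_set F = {}"
    then show False using hausdorff_measure_cf_set_nonzero[OF assms] by (simp add: hausdorff_measure_empty)
  qed
  then have "0 < r" using r hausdorff_measure_0_nonzero by (cases "r = 0") auto
  moreover have "ennreal (4 powr r) < word_sum F r k"
  proof -
    have "ennreal (4 powr r) \<le> ennreal (4 powr s)" using r by (intro ennreal_leI powr_mono) auto
    also note Z
    also have "word_sum F s k \<le> word_sum F r k" using F r by (intro word_sum_antimono) auto
    finally show ?thesis .
  qed
  ultimately show False using hausdorff_measure_cf_set_nonzero[OF F] r by blast
qed

text \<open>Monotone convergence: the digits of a word are at most \<open>sum_list w\<close>, so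
  each word is counted from some truncation on.\<close>

lemma word_sum_eq_SUP: "word_sum A s k = (SUP n. word_sum (A \<inter> {..n}) s k)"
proof (rule antisym)
  let ?g = "\<lambda>A w. ennreal (cden w 0 powr (-2 * s)) * indicator (words A k) w"
  have Zg: "word_sum A s k = (\<integral>\<^sup>+w. ?g A w \<partial>count_space UNIV)" for A
    unfolding word_sum_def by (subst nn_integral_count_space_indicator) auto
  have inc: "incseq (\<lambda>n. ?g (A \<inter> {..n}))"
  proof (intro incseq_SucI le_funI mult_left_mono)
    fix n w
    have "words (A \<inter> {..n}) k \<subseteq> words (A \<inter> {..Suc n}) k" by (auto simp: words_def)
    then show "(indicator (words (A \<inter> {..n}) k) w :: ennreal) \<le> indicator (words (A \<inter> {..Suc n}) k) w"
      by (auto simp: indicator_def)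
  qed simp
  have "word_sum A s k \<le> (\<integral>\<^sup>+w. (SUP n. ?g (A \<inter> {..n}) w) \<partial>count_space UNIV)"
    unfolding Zg
  proof (rule nn_integral_mono)
    fix w
    show "?g A w \<le> (SUP n. ?g (A \<inter> {..n}) w)"
    proof (cases "w \<in> words A k")
      case True
      then have "w \<in> words (A \<inter> {..sum_list w}) k"
        by (auto simp: words_def member_le_sum_list)
      then have "?g A w = ?g (A \<inter> {..sum_list w}) w" using True by simp
      also have "\<dots> \<le> (SUP n. ?g (A \<inter> {..n}) w)" by (rule SUP_upper) simp
      finally show ?thesis .
    qed simp
  qed
  also have "\<dots> = (SUP n. \<integral>\<^sup>+w. ?g (A \<inter> {..n}) w \<partial>count_space UNIV)"
    by (rule nn_integral_monotone_convergence_SUP[OF inc]) simp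
  finally show "word_sum A s k \<le> (SUP n. word_sum (A \<inter> {..n}) s k)" by (simp add: Zg)
  show "(SUP n. word_sum (A \<inter> {..n}) s k) \<le> word_sum A s k"
    unfolding Zg by (intro SUP_least nn_integral_mono) (auto simp: words_def indicator_def)
qed

text \<open>Continuants of words of length \<open>2 * m\<close> are at least \<open>2 ^ m\<close>,
  so a smaller exponent gains a factor exponential in \<open>m\<close>, enough to beat any
  constant.\<close>

lemma word_sum_growth:
  assumes A: "0 \<notin> A" and "r \<le> s"
  shows "ennreal (2 powr (2 * real m * (s - r))) * word_sum A s (2 * m) \<le> word_sum A r (2 * m)"
proof -
  have "ennreal (2 powr (2 * real m * (s - r))) * word_sum A s (2 * m) =
    (\<integral>\<^sup>+w. ennreal (2 powr (2 * real m * (s - r))) * ennreal (cden w 0 powr (-2 * s))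
      \<partial>count_space (words A (2 * m)))"
    unfolding word_sum_def by (subst nn_integral_cmult) auto
  also have "\<dots> \<le> word_sum A r (2 * m)"
    unfolding word_sum_def
  proof (rule nn_integral_mono)
    fix w assume "w \<in> space (count_space (words A (2 * m)))"
    then have w: "0 \<notin> set w" "length w = 2 * m" using words_pos[OF A] by (auto simp: words_def)
    have q: "0 < cden w 0" "2 ^ m \<le> cden w 0"
      using cden_pos[OF w(1)] cden_growth[OF w(1)] w(2) by auto
    have "2 powr (2 * real m * (s - r)) = (2 ^ m) powr (2 * (s - r))"
      by (simp add: powr_powr ac_simps flip: powr_realpow)
    also have "\<dots> \<le> cden w 0 powr (2 * (s - r))"
      using q assms by (intro powr_mono2) auto
    finally have "2 powr (2 * real m * (s - r)) * cden w 0 powr (-2 * s) \<le>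
      cden w 0 powr (2 * (s - r)) * cden w 0 powr (-2 * s)"
      by (intro mult_right_mono) auto
    also have "\<dots> = cden w 0 powr (-2 * r)"
      by (simp add: algebra_simps flip: powr_add)
    finally show "ennreal (2 powr (2 * real m * (s - r))) * ennreal (cden w 0 powr (-2 * s)) \<le>
      ennreal (cden w 0 powr (-2 * r))"
      by (simp add: ennreal_leI flip: ennreal_mult)
  qed
  finally show ?thesis .
qed

lemma finite_subset_dim_ge:
  assumes A: "0 \<notin> A" and r: "0 < r" "r < s" and Z: "\<And>k. 1 \<le> word_sum A s k"
  obtains F where "finite F" "F \<subseteq> A" "r \<le> hausdorff_dim (cf_set F)"
proof -
  \<comment> \<open>This \<open>m\<close> makes the gain \<open>2 powr (2 * m * (s - r))\<close>
    exceed the distortion constant \<open>4 powr r\<close>. The strict inequality then survives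
    truncation to finitely many digits.\<close>
  obtain m :: nat where m: "r / (s - r) < real m" using reals_Archimedean2 by blast
  have "4 powr r = 2 powr (2 * r)"
    by (simp flip: powr_powr)
  also have "2 * r < 2 * real m * (s - r)" using m r by (simp add: field_simps)
  finally have "ennreal (4 powr r) < ennreal (2 powr (2 * real m * (s - r)))"
    by (simp add: ennreal_less_iff)
  also have "\<dots> \<le> ennreal (2 powr (2 * real m * (s - r))) * word_sum A s (2 * m)"
    using mult_left_mono[OF Z[of "2 * m"], of "ennreal (2 powr (2 * real m * (s - r)))"] by simp
  also have "\<dots> \<le> word_sum A r (2 * m)" using A r by (intro word_sum_growth) auto
  finally obtain n where "ennreal (4 powr r) < word_sum (A \<inter> {..n}) r (2 * m)"
    unfolding word_sum_eq_SUP[of A] less_SUP_iff by blast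
  then have "r \<le> hausdorff_dim (cf_set (A \<inter> {..n}))"
    using A r by (intro cf_dim_ge_of_word_sum) auto
  then show ?thesis using that[of "A \<inter> {..n}"] by auto
qed

lemma cf_dim_ge:
  assumes A: "0 \<notin> A" and s: "0 \<le> s" and Z: "\<And>k. 1 \<le> word_sum A s k"
  shows "s \<le> hausdorff_dim (cf_set A)"
proof (rule dense_le)
  fix r assume "r < s"
  show "r \<le> hausdorff_dim (cf_set A)"
  proof (cases "0 < r")
    case True
    then obtain F where "F \<subseteq> A" "r \<le> hausdorff_dim (cf_set F)"
      using finite_subset_dim_ge[OF A True \<open>r < s\<close> Z] by blast
    then show ?thesis using cf_dim_mono[of F A] A by linarith
  qed (use cf_dim_nonneg[OF A] in linarith)
qed

section \<open>Sums over one digit\<close>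

lemma digit_sum_Un_le: "digit_sum (A \<union> B) s t \<le> digit_sum A s t + digit_sum B s t"
  unfolding digit_sum_def
  by (simp add: nn_integral_count_space_indicator nn_integral_add[symmetric])
     (auto intro!: nn_integral_mono simp: indicator_def)

lemma digit_sum_Un:
  "A \<inter> B = {} \<Longrightarrow> digit_sum (A \<union> B) s t = digit_sum A s t + digit_sum B s t"
  unfolding digit_sum_def
  by (simp add: nn_integral_count_space_indicator nn_integral_add[symmetric])
     (auto intro!: nn_integral_cong simp: indicator_def)

lemma digit_sum_finite:
  "finite A \<Longrightarrow> digit_sum A s t = ennreal (\<Sum>c\<in>A. (real c + t) powr (-2 * s))"
  by (simp add: digit_sum_def nn_integral_count_space_finite)

lemma digit_sum_mono: "A \<subseteq> B \<Longrightarrow> digit_sum A s t \<le> digit_sum B s t"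
  unfolding digit_sum_def
  by (auto intro!: nn_integral_mono simp: nn_integral_count_space_indicator indicator_def)

lemma word_sum_less_1_of_dim_less:
  assumes "0 \<notin> A" "hausdorff_dim (cf_set A) < s"
  obtains k where "word_sum A s k < 1"
proof (rule ccontr)
  assume "\<not> thesis"
  then have "1 \<le> word_sum A s k" for k using that not_le by blast
  moreover have "0 \<le> s" using cf_dim_nonneg[OF assms(1)] assms(2) by linarith
  ultimately have "s \<le> hausdorff_dim (cf_set A)" using cf_dim_ge assms by blast
  then show False using assms by simp
qed

text \<open>A large additional digit raises all digit sums by a factor close to 1 only.\<close>
lemma cf_dim_insert_large:
  assumes A: "0 \<notin> A" "a \<in> A" and dim: "hausdorff_dim (cf_set A) < s"
  obtains N where "\<And>c. N \<le> c \<Longrightarrow> hausdorff_dim (cf_set (insert c A)) \<le> s"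
proof -
  have s: "0 < s" using cf_dim_nonneg[OF A(1)] dim by linarith
  obtain k where k: "word_sum A s k < 1" using word_sum_less_1_of_dim_less[OF A(1) dim] by blast
  obtain z where z: "word_sum A s k = ennreal z" "0 \<le> z" "z < 1"
    using k by (cases "word_sum A s k") (auto simp: ennreal_less_one_iff)
  \<comment> \<open>The length \<open>k\<close> is fixed and \<open>z < 1\<close>, so a small
    relative error \<open>\<eta>\<close> per digit still leaves the word sum below 1.\<close>
  have "((\<lambda>\<eta>. (1 + \<eta>) ^ k * z) \<longlongrightarrow> (1 + 0) ^ k * z) (at_right 0)"
    by (intro tendsto_intros)
  then have "\<forall>\<^sub>F \<eta> in at_right 0. (1 + \<eta>) ^ k * z < 1"
    by (rule order_tendstoD) (use z in simp)
  then have "\<forall>\<^sub>F \<eta> in at_right (0::real). (1 + \<eta>) ^ k * z < 1 \<and> 0 < \<eta>"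
    by (intro eventually_conj eventually_at_right_less)
  then obtain \<eta> where \<eta>: "(1 + \<eta>) ^ k * z < 1" "0 < \<eta>"
    using eventually_happens'[OF trivial_limit_at_right_real] by blast
  \<comment> \<open>A digit exceeding a digit \<open>a\<close> of \<open>A\<close> by the factor
    \<open>R\<close> contributes at most \<open>\<eta>\<close> times as much as \<open>a\<close>;
    the \<open>a + 2\<close> below covers all shifts.\<close>
  define R where "R = \<eta> powr (- 1 / (2 * s))"
  have R: "0 < R" "R powr (-2 * s) = \<eta>" using \<eta> s by (auto simp: R_def powr_powr)
  obtain N :: nat where N: "R * (real a + 2) < real N" using reals_Archimedean2 by blast
  show ?thesis
  proof (rule that[of N])
    fix c assume "N \<le> c"
    then have c: "R * (real a + 2) < real c" using N by linarith
    have c0: "0 < real c" using c R by (smt (verit) mult_nonneg_nonneg of_nat_0_le_iff)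
    have "word_sum (insert c A) s k \<le> ennreal (1 + \<eta>) ^ k * word_sum A s k"
    proof (rule word_sum_le_of_digit_sum)
      show "0 \<notin> insert c A" using A c0 by auto
      fix t :: real assume t: "0 \<le> t" "t \<le> 2"
      have a: "0 < real a" using A by (metis gr0I of_nat_0_less_iff)
      have "R * (real a + t) \<le> R * (real a + 2)" using R t by (intro mult_left_mono) auto
      then have "R * (real a + t) \<le> real c + t" using c t by linarith
      then have "(real c + t) powr (-2 * s) \<le> (R * (real a + t)) powr (-2 * s)"
        using R a t s by (intro powr_mono2') auto
      also have "\<dots> = \<eta> * (real a + t) powr (-2 * s)" by (simp add: powr_mult flip: R(2))
      finally have "digit_sum {c} s t \<le> ennreal \<eta> * digit_sum {a} s t"
        using \<eta> by (simp add: digit_sum_finite ennreal_leI flip: ennreal_mult)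
      also have "\<dots> \<le> ennreal \<eta> * digit_sum A s t"
        using A by (intro mult_left_mono digit_sum_mono) auto
      finally have "digit_sum {c} s t \<le> ennreal \<eta> * digit_sum A s t" .
      then have "digit_sum (A \<union> {c}) s t \<le> digit_sum A s t + ennreal \<eta> * digit_sum A s t"
        by (intro order_trans[OF digit_sum_Un_le] add_left_mono)
      also have "\<dots> = ennreal (1 + \<eta>) * digit_sum A s t"
        using \<eta> by (simp add: distrib_right)
      finally show "digit_sum (insert c A) s t \<le> ennreal (1 + \<eta>) * digit_sum A s t" by simp
    qed (use A in auto)
    also have "\<dots> = ennreal ((1 + \<eta>) ^ k * z)" using \<eta> z by (simp add: ennreal_power ennreal_mult del: ennreal_plus)
    also have "\<dots> < 1" using \<eta> by (simp add: ennreal_less_one_iff)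
    finally show "hausdorff_dim (cf_set (insert c A)) \<le> s"
      using A c0 s by (intro cf_dim_le_of_word_sum) auto
  qed
qed


section \<open>Small dimensions\<close>

lemma lucas_pos: "0 < lucas n"
  by (induction n rule: lucas.induct) auto

lemma zero_notin_lucas: "0 \<notin> lucas ` X"
  using lucas_pos by (metis imageE less_irrefl)

lemma lucas_Suc_strict_mono: "strict_mono (\<lambda>n. lucas (Suc n))"
proof (rule strict_monoI_Suc)
  show "lucas (Suc n) < lucas (Suc (Suc n))" for n using lucas_pos[of n] by simp
qed

text \<open>The sequence starts with 2, 1, 3 and increases strictly only from index 1, so the value
  2 is separated by hand.\<close>

lemma inj_lucas: "inj lucas"
proof -
  have inj: "inj (\<lambda>n. lucas (Suc n))" using lucas_Suc_strict_mono by (rule strict_mono_imp_inj_on)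
  have ne: "lucas (Suc n) \<noteq> 2" for n
  proof (cases n)
    case (Suc m)
    then show ?thesis
      using strict_mono_less_eq[OF lucas_Suc_strict_mono, of 1 n] by simp
  qed simp
  have two: "n = 0" if "lucas n = 2" for n
    using ne that by (metis not0_implies_Suc)
  show ?thesis
  proof (rule injI)
    fix m n assume eq: "lucas m = lucas n"
    show "m = n"
    proof (cases "m = 0 \<or> n = 0")
      case True
      then show ?thesis using eq two[of m] two[of n] by auto
    next
      case False
      then obtain m' n' where "m = Suc m'" "n = Suc n'" by (metis not0_implies_Suc)
      then show ?thesis using eq injD[OF inj] by simp
    qed
  qed
qed

lemma lucas_ge: "n \<le> lucas n"
proof (cases n)
  case (Suc m)
  have "m + 1 \<le> lucas (Suc m)"
  proof (induction m)
    case (Suc m)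
    then show ?case using lucas_pos[of m] by simp
  qed simp
  then show ?thesis using Suc by simp
qed simp

text \<open>Equality holds in the step from 1 to 3, and the factor 4 derived for two steps is
  attained from 1 to 4.\<close>

lemma lucas_Suc_le: "lucas (Suc n) \<le> 3 * lucas n"
proof (induction n rule: lucas.induct)
  case (3 n)
  then show ?case using lucas_pos[of n] by simp
qed auto

lemma lucas_Suc_Suc_le: "lucas (Suc (Suc n)) \<le> 4 * lucas n"
  using lucas_Suc_le[of n] by simp

text \<open>The origin of the bound \<open>1 / 4\<close>: both successors are at most four times as
  large, a nonnegative shift preserves this, and \<open>4 powr (-2 * s)\<close> is at least
  \<open>1 / 2\<close> when \<open>s \<le> 1 / 4\<close>. So each successor carries at least half of
  the term.\<close>

lemma digit_sum_lucas_le: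
  assumes "0 \<le> s" "s \<le> 1 / 4" "0 \<le> t"
  shows "digit_sum {lucas n} s t \<le> digit_sum {lucas (Suc n), lucas (Suc (Suc n))} s t"
proof -
  let ?f = "\<lambda>c. (real c + t) powr (-2 * s)"
  have half: "?f (lucas n) / 2 \<le> ?f c" if "c \<le> 4 * lucas n" "0 < c" for c
  proof -
    have "real c \<le> 4 * real (lucas n)" using that(1) by (metis of_nat_le_iff of_nat_mult of_nat_numeral)
    then have le: "real c + t \<le> 4 * (real (lucas n) + t)" 
      using add_mono[of "real c" "4 * real (lucas n)" t "4 * t"] assms(3) by simp
    have "1 / 2 = (4::real) powr (- (1 / 2))" by (simp add: powr_minus_divide powr_half_sqrt)
    also have "\<dots> \<le> 4 powr (-2 * s)" using assms by (intro powr_mono) auto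
    finally have "?f (lucas n) / 2 \<le> 4 powr (-2 * s) * ?f (lucas n)"
      using mult_right_mono[of "1 / 2" "4 powr (-2 * s)" "?f (lucas n)"] by simp
    also have "\<dots> = (4 * (real (lucas n) + t)) powr (-2 * s)"
      by (rule powr_mult[symmetric])
    also have "\<dots> \<le> ?f c" using le assms that by (intro powr_mono2') auto
    finally show ?thesis .
  qed
  have ne: "lucas (Suc n) \<noteq> lucas (Suc (Suc n))" using injD[OF inj_lucas] by (metis n_not_Suc_n)
  have "?f (lucas n) \<le> ?f (lucas (Suc n)) + ?f (lucas (Suc (Suc n)))"
    using half[of "lucas (Suc n)"] half[of "lucas (Suc (Suc n))"] lucas_Suc_le[of n]
      lucas_Suc_Suc_le[of n] lucas_pos[of "Suc n"] lucas_pos[of "Suc (Suc n)"] lucas_pos[of n]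
    by (simp del: lucas.simps)
  then show ?thesis using ne 
    by (simp add: digit_sum_finite ennreal_leI del: lucas.simps flip: ennreal_plus)
qed

primrec greedy :: "real \<Rightarrow> nat \<Rightarrow> nat set" where
  "greedy t 0 = {}"
| "greedy t (Suc n) =
    (if hausdorff_dim (cf_set (insert (lucas n) (greedy t n))) \<le> t
     then insert (lucas n) (greedy t n) else greedy t n)"

lemma dim_empty: "hausdorff_dim (cf_set {}) = 0"
proof -
  have "hausdorff_dim (cf_set {}) \<le> 0"
    by (rule hausdorff_dim_le) (simp_all add: hausdorff_measure_empty)
  then show ?thesis using cf_dim_nonneg[of "{}"] by simp
qed

text \<open>Guarantees that the greedy choice accepts its first digit, which gives
  \<open>cf_dim_insert_large\<close> a digit to compare with.\<close>

lemma dim_lucas_0: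
  assumes "0 < t"
  shows "hausdorff_dim (cf_set {lucas 0}) \<le> t"
proof (rule cf_dim_le_of_word_sum)
  have "words {2} 1 = {[2]}" by (auto simp: words_def length_Suc_conv)
  then have "word_sum {2} t 1 = ennreal (2 powr (-2 * t))"
    by (simp add: word_sum_def nn_integral_count_space_finite)
  also have "\<dots> < 1" using assms by (simp add: ennreal_less_one_iff powr_less_one)
  finally show "word_sum {lucas 0} t 1 < 1" by simp
qed (use assms in auto)

text \<open>If the greedy set fell short of \<open>t\<close>, large digits could always be added, so
  only finitely many were rejected. The last rejected digit is dominated by its two accepted
  successors; accepting it would thus have kept the dimension below \<open>t\<close>.\<close>

lemma small_dim_attained:
  assumes t: "0 < t" "t \<le> 1 / 4" and full: "t < hausdorff_dim (cf_set lucas_set)"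
  shows "t \<in> dim_spectrum lucas_set"
proof -
  let ?d = "\<lambda>A. hausdorff_dim (cf_set A)"
  define Inc where "Inc m \<longleftrightarrow> ?d (insert (lucas m) (greedy t m)) \<le> t" for m
  define A where "A = lucas ` {m. Inc m}"
  have G: "greedy t n = lucas ` {m. m < n \<and> Inc m}" for n
  proof (induction n)
    case (Suc n)
    have "{m. m < Suc n \<and> Inc m} = (if Inc n then insert n {m. m < n \<and> Inc m} else {m. m < n \<and> Inc m})"
      by (auto simp: less_Suc_eq)
    then show ?case using Suc by (simp add: Inc_def)
  qed simp
  have dG: "?d (greedy t n) \<le> t" for n
    by (induction n) (use t dim_empty in auto)
  have A0: "0 \<notin> A" unfolding A_def by (rule zero_notin_lucas)
  \<comment> \<open>The dimension of \<open>A\<close> is approximated by finite subsets, and each of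
    them lies in some stage \<open>greedy t n\<close>.\<close>
  have "?d A \<le> t"
  proof (rule ccontr)
    assume "\<not> ?d A \<le> t"
    then obtain s where s: "t < s" "s < ?d A" using dense not_le by blast
    obtain r where r: "t < r" "r < s" using dense s by blast
    have "1 \<le> word_sum A s k" for k
      using cf_dim_le_of_word_sum[OF A0, of s k] s t by (meson linorder_not_le order.strict_trans less_imp_le)
    then obtain E where E: "finite E" "E \<subseteq> A" "r \<le> ?d E"
      using finite_subset_dim_ge[OF A0 _ r(2)] t r by (metis order.strict_trans)
    then obtain C where C: "C \<subseteq> {m. Inc m}" "finite C" "E = lucas ` C"
      unfolding A_def using finite_subset_image by metis
    then obtain n where "C \<subseteq> {..<n}" using finite_nat_bounded by blast
    then have "E \<subseteq> greedy t n" using C unfolding G by auto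
    then have "?d E \<le> t" using cf_dim_mono[of E "greedy t n"] dG[of n] zero_notin_lucas G
      by (metis order_trans)
    then show False using E r by simp
  qed
  moreover have "t \<le> ?d A"
  proof (rule ccontr)
    assume "\<not> t \<le> ?d A"
    then obtain s where s: "?d A < s" "s < t" using dense not_le by blast
    have "Inc 0" unfolding Inc_def using dim_lucas_0[OF t(1)] by simp
    then have "lucas 0 \<in> A" unfolding A_def by blast
    then obtain N where N: "\<And>c. N \<le> c \<Longrightarrow> ?d (insert c A) \<le> s"
      using cf_dim_insert_large[OF A0 _ s(1)] by blast
    have late: "Inc n" if "N \<le> n" for n
    proof -
      have "?d (insert (lucas n) (greedy t n)) \<le> ?d (insert (lucas n) A)"
      proof (rule cf_dim_mono)
        show "insert (lucas n) (greedy t n) \<subseteq> insert (lucas n) A" unfolding G A_def by auto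
        show "0 \<notin> insert (lucas n) A" using A0 lucas_pos[of n] by auto
      qed
      also have "\<dots> \<le> s" using N[of "lucas n"] lucas_ge[of n] that by auto
      finally show ?thesis using s by (simp add: Inc_def)
    qed
    show False
    proof (cases "\<exists>m. \<not> Inc m")
      case False
      then have "A = lucas_set" by (simp add: A_def lucas_set_def)
      then show False using full s by simp
    next
      case True
      have "{m. \<not> Inc m} \<subseteq> {..<N}" using late linorder_not_le by blast
      then have fin: "finite {m. \<not> Inc m}" by (rule finite_subset) simp
      define m where "m = Max {m. \<not> Inc m}"
      have m: "\<not> Inc m" using Max_in[OF fin] True by (auto simp: m_def)
      have after: "Inc n" if "m < n" for n
        using Max_ge[OF fin, of n] that by (auto simp: m_def)
      let ?G = "greedy t m" and ?P = "{lucas (Suc m), lucas (Suc (Suc m))}"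
      have disj: "?G \<inter> ?P = {}"
        unfolding G using injD[OF inj_lucas] by fastforce
      have sub: "?G \<union> ?P \<subseteq> A"
        unfolding G A_def using after[of "Suc m"] after[of "Suc (Suc m)"]
        by (auto simp del: lucas.simps)
      obtain k where k: "word_sum A s k < 1" using word_sum_less_1_of_dim_less[OF A0 s(1)] by blast
      have s0: "0 < s" using cf_dim_nonneg[OF A0] s by linarith
      have nG: "0 \<notin> insert (lucas m) ?G" unfolding G using zero_notin_lucas lucas_pos[of m] by auto
      \<comment> \<open>Trading the digits of index \<open>m + 1\<close> and \<open>m + 2\<close>
        for the one of index \<open>m\<close> does not increase any digit sum, so the factor is 1
        and the word sum stays below 1.\<close>
      have "word_sum (insert (lucas m) ?G) s k \<le> 1 ^ k * word_sum A s k"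
      proof (rule word_sum_le_of_digit_sum[OF A0 nG])
        fix x :: real assume x: "0 \<le> x" "x \<le> 2"
        have "digit_sum (?G \<union> {lucas m}) s x \<le> digit_sum ?G s x + digit_sum {lucas m} s x"
          by (rule digit_sum_Un_le)
        also have "\<dots> \<le> digit_sum ?G s x + digit_sum ?P s x"
          using s0 s t x by (intro add_left_mono digit_sum_lucas_le) auto
        also have "\<dots> = digit_sum (?G \<union> ?P) s x" by (rule digit_sum_Un[OF disj, symmetric])
        also have "\<dots> \<le> digit_sum A s x" by (rule digit_sum_mono[OF sub])
        finally show "digit_sum (insert (lucas m) ?G) s x \<le> 1 * digit_sum A s x" by simp
      qed
      then have "word_sum (insert (lucas m) ?G) s k < 1" using k by simp
      then have "?d (insert (lucas m) ?G) \<le> s" using cf_dim_le_of_word_sum[OF nG] s0 by simp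
      then show False using m s by (simp add: Inc_def)
    qed
  qed
  ultimately have "?d A = t" by simp
  moreover have "A \<subseteq> lucas_set" by (auto simp: A_def lucas_set_def)
  ultimately show ?thesis unfolding dim_spectrum_def by blast
qed

section \<open>A gap\<close>

lemma power_powr: "(x ^ n) powr a = (x powr a) ^ n" for x a :: real
  by (induction n) (auto simp: powr_mult)

text \<open>Certifies lower bounds for powers with exponent \<open>3 / 2\<close> by rational
  arithmetic.\<close>

lemma le_powr_3_2:
  fixes a b :: real
  assumes "0 \<le> a" "0 \<le> b" "b ^ 2 \<le> a ^ 3"
  shows "b \<le> a powr (3 / 2)"
proof (cases "a = 0")
  case False
  then have "a ^ 3 = (a powr (3 / 2)) ^ 2"
    using assms(1) by (simp add: power2_eq_square flip: powr_add)
  then show ?thesis using assms by (metis powr_ge_zero power2_le_imp_le)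
qed (use assms in auto)

text \<open>The form of the test function makes every summand of its image a pure power, because
  \<open>(c + z) * (1 + 1 / (2 * (c + z)))\<close> equals \<open>c + z + 1 / 2\<close>.\<close>

lemma test_function_ineq:
  fixes z :: real
  assumes "0 \<le> z" "z \<le> 1"
  shows "(1 + z / 2) powr (-3 / 2) \<le> (\<Sum>c\<in>{1, 2, 3, 4, 7::nat}. (real c + z + 1 / 2) powr (-3 / 2))"
proof -
  have bound: "b * (1 + z / 2) powr (-3 / 2) \<le> (x + z + 1 / 2) powr (-3 / 2)"
    if "0 < x" "0 \<le> a" "0 \<le> b" "b ^ 2 \<le> a ^ 3" "a * (x + z + 1 / 2) \<le> 1 + z / 2" for a b x :: real
  proof -
    let ?X = "x + z + 1 / 2" and ?Y = "1 + z / 2"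
    have p: "0 < ?X" "0 < ?Y" using that assms by auto
    have "b \<le> a powr (3 / 2)" using that by (intro le_powr_3_2) auto
    also have "\<dots> \<le> (?Y / ?X) powr (3 / 2)"
      using that p by (intro powr_mono2) (auto simp: field_simps)
    also have "\<dots> = ?Y powr (3 / 2) / ?X powr (3 / 2)" by (rule powr_divide)
    finally have "b * ?Y powr (-3 / 2) \<le> ?Y powr (3 / 2) / ?X powr (3 / 2) * ?Y powr (-3 / 2)"
      by (intro mult_right_mono) auto
    also have "\<dots> = ?X powr (-3 / 2)"
      using p by (simp add: powr_minus_divide field_simps)
    finally show ?thesis .
  qed
  let ?Y = "(1 + z / 2) powr (-3 / 2)"
  \<comment> \<open>Each \<open>a\<close> is the minimum of
    \<open>(1 + z / 2) / (c + z + 1 / 2)\<close> over the unit interval, taken at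
    \<open>z = 1\<close> for the digit 1 and at \<open>z = 0\<close> for the others. Each factor is
    a rational slightly below \<open>a powr (3 / 2)\<close>; together they give 1.02.\<close>
  have "464 / 1000 * ?Y \<le> (1 + z + 1 / 2) powr (-3 / 2)"
    by (rule bound[of _ "3 / 5"]) (use assms in \<open>auto simp: power2_eq_square power3_eq_cube\<close>)
  moreover have "252 / 1000 * ?Y \<le> (2 + z + 1 / 2) powr (-3 / 2)"
    by (rule bound[of _ "2 / 5"]) (use assms in \<open>auto simp: power2_eq_square power3_eq_cube\<close>)
  moreover have "152 / 1000 * ?Y \<le> (3 + z + 1 / 2) powr (-3 / 2)"
    by (rule bound[of _ "2 / 7"]) (use assms in \<open>auto simp: power2_eq_square power3_eq_cube\<close>)
  moreover have "104 / 1000 * ?Y \<le> (4 + z + 1 / 2) powr (-3 / 2)"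
    by (rule bound[of _ "2 / 9"]) (use assms in \<open>auto simp: power2_eq_square power3_eq_cube\<close>)
  moreover have "48 / 1000 * ?Y \<le> (7 + z + 1 / 2) powr (-3 / 2)"
    by (rule bound[of _ "2 / 15"]) (use assms in \<open>auto simp: power2_eq_square power3_eq_cube\<close>)
  moreover have "0 \<le> ?Y" by simp
  ultimately have "?Y \<le> (1 + z + 1 / 2) powr (-3 / 2) + (2 + z + 1 / 2) powr (-3 / 2) +
    (3 + z + 1 / 2) powr (-3 / 2) + (4 + z + 1 / 2) powr (-3 / 2) + (7 + z + 1 / 2) powr (-3 / 2)"
    by linarith
  then show ?thesis by simp
qed

text \<open>
  The transfer operator of the digits 1, 2, 3, 4, 7 at exponent 3/4 does not decrease the test
  function \<open>\<lambda>x. (1 + x / 2) powr (-3 / 2)\<close>.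
\<close>
lemma dim_12347_ge: "3 / 4 \<le> hausdorff_dim (cf_set {1, 2, 3, 4, 7})"
proof -
  let ?A = "{1, 2, 3, 4, 7 :: nat}"
  let ?g = "\<lambda>w. ennreal ((cden w 0 * (1 + cmap w 0 / 2)) powr (-3 / 2))"
  have A0: "0 \<notin> ?A" by simp
  have G: "1 \<le> (\<integral>\<^sup>+w. ?g w \<partial>count_space (words ?A k))" for k
  proof (induction k)
    case 0
    then show ?case by (simp add: nn_integral_count_space_finite)
  next
    case (Suc k)
    note Suc
    also have "(\<integral>\<^sup>+w. ?g w \<partial>count_space (words ?A k)) \<le>
      (\<integral>\<^sup>+w. \<integral>\<^sup>+c. ?g (c # w) \<partial>count_space ?A \<partial>count_space (words ?A k))"
    proof (rule nn_integral_mono)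
      fix w assume "w \<in> space (count_space (words ?A k))"
      then have w: "0 \<notin> set w" using words_pos[OF A0] by simp
      define z where "z = cmap w 0"
      have z: "0 \<le> z" "z \<le> 1" using cmap_nonneg[of 0 w] cmap_le_1[OF w, of 0] by (auto simp: z_def)
      have q: "0 < cden w 0" using cden_pos[OF w] by simp
      have e: "(cden (c # w) 0 * (1 + cmap (c # w) 0 / 2)) powr (-3 / 2) =
        (real c + z + 1 / 2) powr (-3 / 2) * cden w 0 powr (-3 / 2)" if "c \<in> ?A" for c
      proof -
        have "0 < real c + z" using that z by auto
        then have "cden (c # w) 0 * (1 + cmap (c # w) 0 / 2) = (real c + z + 1 / 2) * cden w 0"
          by (simp add: z_def[symmetric] field_simps)
        then show ?thesis by (simp only: powr_mult)
      qed
      have "(cden w 0 * (1 + cmap w 0 / 2)) powr (-3 / 2) =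
        (1 + z / 2) powr (-3 / 2) * cden w 0 powr (-3 / 2)"
        unfolding z_def[symmetric] by (simp only: powr_mult mult.commute)
      also have "\<dots> \<le> (\<Sum>c\<in>?A. (real c + z + 1 / 2) powr (-3 / 2)) * cden w 0 powr (-3 / 2)"
        by (intro mult_right_mono test_function_ineq z) auto
      also have "\<dots> = (\<Sum>c\<in>?A. (cden (c # w) 0 * (1 + cmap (c # w) 0 / 2)) powr (-3 / 2))"
        unfolding sum_distrib_right by (intro sum.cong refl e[symmetric])
      finally have "?g w \<le> ennreal (\<Sum>c\<in>?A. (cden (c # w) 0 * (1 + cmap (c # w) 0 / 2)) powr (-3 / 2))"
        by (rule ennreal_leI)
      also have "\<dots> = (\<Sum>c\<in>?A. ?g (c # w))" by (rule sum_ennreal[symmetric]) simp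
      also have "\<dots> = (\<integral>\<^sup>+c. ?g (c # w) \<partial>count_space ?A)"
        by (rule nn_integral_count_space_finite[symmetric]) simp
      finally show "?g w \<le> (\<integral>\<^sup>+c. ?g (c # w) \<partial>count_space ?A)" .
    qed
    also have "\<dots> = (\<integral>\<^sup>+c. \<integral>\<^sup>+w. ?g (c # w) \<partial>count_space (words ?A k) \<partial>count_space ?A)"
      by (rule nn_integral_count_space_nn_integral) auto
    also have "\<dots> = (\<integral>\<^sup>+w. ?g w \<partial>count_space (words ?A (Suc k)))"
      by (rule nn_integral_words_Suc[symmetric])
    finally show ?case .
  qed
  show ?thesis
  proof (rule cf_dim_ge[OF A0])
    fix k
    have "1 \<le> (\<integral>\<^sup>+w. ?g w \<partial>count_space (words ?A k))" by (rule G)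
    also have "\<dots> \<le> word_sum ?A (3 / 4) k"
      unfolding word_sum_def
    proof (rule nn_integral_mono)
      fix w assume "w \<in> space (count_space (words ?A k))"
      then have w: "0 \<notin> set w" using words_pos[OF A0] by simp
      have q: "0 < cden w 0" using cden_pos[OF w] by simp
      have "cden w 0 * 1 \<le> cden w 0 * (1 + cmap w 0 / 2)"
        using q cmap_nonneg[of 0 w] by (intro mult_left_mono) auto
      then show "?g w \<le> ennreal (cden w 0 powr (-2 * (3 / 4)))"
        using q by (intro ennreal_leI) (auto intro!: powr_mono2')
    qed
    finally show "1 \<le> word_sum ?A (3 / 4) k" .
  qed simp
qed

section \<open>Lucas digits beyond 76\<close>

lemma lucas_9: "lucas 9 = 76" "lucas 10 = 123" "lucas 11 = 199"
  by (simp_all add: eval_nat_numeral)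

text \<open>The 6 is \<open>3 * 2\<close>: a quotient of at least \<open>8 / 5\<close> after adding
  \<open>t\<close> to both terms requires a surplus \<open>3 * t\<close> with
  \<open>t \<le> 2\<close>. At 76 this reads 614 against 615, whereas at 47 it fails with 382
  against 380. Adding two consecutive instances gives the next.\<close>

lemma lucas_ratio: "8 * lucas (n + 9) + 6 \<le> 5 * lucas (n + 10)"
proof (induction n rule: less_induct)
  case (less n)
  consider "n = 0" | "n = 1" | k where "n = Suc (Suc k)"
    by (metis One_nat_def not0_implies_Suc)
  then show ?case
  proof cases
    case 1
    then show ?thesis using lucas_9 by simp
  next
    case 2
    then show ?thesis using lucas_9 by simp
  next
    case 3
    have "8 * lucas (k + 9) + 6 \<le> 5 * lucas (k + 10)" by (rule less.IH) (simp add: 3)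
    moreover have "8 * lucas (Suc k + 9) + 6 \<le> 5 * lucas (Suc k + 10)" by (rule less.IH) (simp add: 3)
    moreover have "lucas (n + 9) = lucas (Suc k + 9) + lucas (k + 9)"
      "lucas (n + 10) = lucas (Suc k + 10) + lucas (k + 10)"
      using 3 lucas.simps(3)[of "k + 9"] lucas.simps(3)[of "k + 10"] by simp_all
    ultimately show ?thesis by linarith
  qed
qed

lemma lucas_tail_ge:
  assumes "0 \<le> t" "t \<le> 2"
  shows "(8 / 5) ^ i * (76 + t) \<le> real (lucas (i + 9)) + t"
proof (induction i)
  case 0
  then show ?case using lucas_9 by simp
next
  case (Suc i)
  have "real (8 * lucas (i + 9) + 6) \<le> real (5 * lucas (i + 10))"
    using lucas_ratio of_nat_le_iff by blast
  then have "8 / 5 * (real (lucas (i + 9)) + t) \<le> real (lucas (i + 10)) + t"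
    using assms by simp
  moreover have "8 / 5 * ((8 / 5) ^ i * (76 + t)) \<le> 8 / 5 * (real (lucas (i + 9)) + t)"
    using Suc by (rule mult_left_mono) simp
  ultimately have "8 / 5 * ((8 / 5) ^ i * (76 + t)) \<le> real (lucas (i + 10)) + t" by (rule order_trans[rotated])
  moreover have "Suc i + 9 = i + 10" by simp
  ultimately show ?case unfolding power_Suc mult.assoc by (simp only:)
qed

definition tail_ratio :: real where "tail_ratio = (8 / 5) powr (- 37 / 25)"

text \<open>
  The ratio of consecutive Lucas numbers is eventually at least 8/5, and the exponent 37/50 is chosen
  below 3/4 but so large that \<open>tail_ratio < 1 / 2\<close>: the digit sum over a tail is then smaller than the
  term preceding the tail.
\<close>
lemma tail_ratio_bounds: "0 < tail_ratio" "tail_ratio < 1 / 2"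
proof -
  show "0 < tail_ratio" by (simp add: tail_ratio_def)
  have "(2::real) ^ 25 < (8 / 5) ^ 37" by (simp add: power_divide)
  also have "(8 / 5 :: real) ^ 37 = ((8 / 5) powr (37 / 25)) ^ 25" by (simp add: powr_power)
  finally have "2 < (8 / 5 :: real) powr (37 / 25)" by (rule power_less_imp_less_base) simp
  then show "tail_ratio < 1 / 2" by (simp add: tail_ratio_def powr_minus_divide field_simps)
qed

text \<open>Comparison with a geometric series starting from the term of 76, which is itself outside
  the tail; hence the powers \<open>Suc i\<close>. The resulting factor is below 1 because
  \<open>tail_ratio < 1 / 2\<close>.\<close>

lemma lucas_tail_digit_sum:
  assumes s: "37 / 50 \<le> s" and t: "0 \<le> t" "t \<le> 2"
  shows "digit_sum (lucas ` {10..}) s t \<le> ennreal (tail_ratio / (1 - tail_ratio) * (76 + t) powr (-2 * s))"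
proof -
  let ?f = "\<lambda>c. (real c + t) powr (-2 * s)"
  have b: "bij_betw (\<lambda>i. lucas (i + 10)) UNIV (lucas ` {10..})"
  proof (rule bij_betw_imageI)
    show "inj (\<lambda>i. lucas (i + 10))"
    proof (rule injI)
      fix i j assume "lucas (i + 10) = lucas (j + 10)"
      then have "i + 10 = j + 10" by (rule injD[OF inj_lucas])
      then show "i = j" by simp
    qed
    have "{10..} = range (\<lambda>i. i + 10 :: nat)"
      by (metis (no_types, lifting) ext add.commute image_add_atLeast[of 10 0] add_0 atLeast_0)
    then show "range (\<lambda>i. lucas (i + 10)) = lucas ` {10..}" by (simp add: image_image)
  qed
  have th: "?f (lucas (i + 10)) \<le> tail_ratio ^ Suc i * (76 + t) powr (-2 * s)" for i
  proof -
    have "?f (lucas (i + 10)) \<le> ((8 / 5) ^ Suc i * (76 + t)) powr (-2 * s)"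
      using lucas_tail_ge[OF t, of "Suc i"] s t by (intro powr_mono2') (auto simp: add.commute)
    also have "\<dots> = ((8 / 5) powr (-2 * s)) ^ Suc i * (76 + t) powr (-2 * s)"
      by (simp only: powr_mult power_powr)
    also have "\<dots> \<le> tail_ratio ^ Suc i * (76 + t) powr (-2 * s)"
    proof (intro mult_right_mono power_mono)
      show "(8 / 5) powr (-2 * s) \<le> tail_ratio" unfolding tail_ratio_def using s by (intro powr_mono) auto
    qed auto
    finally show ?thesis .
  qed
  have "(\<lambda>i. tail_ratio * tail_ratio ^ i * (76 + t) powr (-2 * s)) sums (tail_ratio * (1 / (1 - tail_ratio)) * (76 + t) powr (-2 * s))"
    using tail_ratio_bounds by (intro sums_mult2 sums_mult geometric_sums) auto
  then have "(\<Sum>i. ennreal (tail_ratio ^ Suc i * (76 + t) powr (-2 * s))) =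
      ennreal (tail_ratio / (1 - tail_ratio) * (76 + t) powr (-2 * s))"
    using tail_ratio_bounds by (intro suminf_ennreal_eq) auto
  moreover have "digit_sum (lucas ` {10..}) s t = (\<Sum>i. ennreal (?f (lucas (i + 10))))"
    unfolding digit_sum_def nn_integral_bij_count_space[OF b, symmetric]
    by (rule nn_integral_count_space_nat)
  moreover have "\<dots> \<le> (\<Sum>i. ennreal (tail_ratio ^ Suc i * (76 + t) powr (-2 * s)))"
    by (intro suminf_le ennreal_leI th) auto
  ultimately show ?thesis by simp
qed

section \<open>Omitting one of the ten digits\<close>

abbreviation initial :: "nat set" where "initial \<equiv> lucas ` {..9}"

lemma initial_eq: "initial = {1, 2, 3, 4, 7, 11, 18, 29, 47, 76}"
proof -
  have "{..9::nat} = {0, 1, 2, 3, 4, 5, 6, 7, 8, 9}" by auto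
  then show ?thesis by (simp only: image_insert image_empty) (auto simp: eval_nat_numeral)
qed

text \<open>The tail replaces at most the share \<open>\<kappa>\<close> of the term of
  \<open>a\<close>, and that term is at least the share \<open>\<eta>\<close> of the whole sum over
  the ten digits. Both shares are independent of \<open>a\<close>, \<open>s\<close> and
  \<open>t\<close>, so the loss is uniform.\<close>

lemma omit_initial_digit_sum:
  "\<exists>r. 0 < r \<and> r < 1 \<and> (\<forall>a\<in>initial. \<forall>s t. 37 / 50 \<le> s \<longrightarrow> s \<le> 2 \<longrightarrow> 0 \<le> t \<longrightarrow> t \<le> 2 \<longrightarrow>
    digit_sum (lucas_set - {a}) s t \<le> ennreal r * digit_sum initial s t)"
proof -
  define \<kappa> where "\<kappa> = tail_ratio / (1 - tail_ratio)"
  \<comment> \<open>Ten terms, each at most the one of digit 1, which exceeds the one of 76 by a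
    factor of at most \<open>76 powr 4\<close>, since \<open>s \<le> 2\<close> and
    \<open>76 + t \<le> 76 * (1 + t)\<close>.\<close>
  define \<eta> :: real where "\<eta> = 76 powr (-4) / 10"
  have \<kappa>: "0 < \<kappa>" "\<kappa> < 1" using tail_ratio_bounds by (auto simp: \<kappa>_def)
  have \<eta>: "0 < \<eta>" "\<eta> < 1" by (auto simp: \<eta>_def powr_minus_divide)
  define r where "r = 1 - (1 - \<kappa>) * \<eta>"
  have "(1 - \<kappa>) * \<eta> < 1 * 1" using \<kappa> \<eta> by (intro mult_strict_mono) auto
  then have r: "0 < r" "r < 1" using \<kappa> \<eta> by (auto simp: r_def)
  have "digit_sum (lucas_set - {a}) s t \<le> ennreal r * digit_sum initial s t"
    if a: "a \<in> initial" and s: "37 / 50 \<le> s" "s \<le> 2" and t: "0 \<le> t" "t \<le> 2" for a s t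
  proof -
    let ?f = "\<lambda>c. (real c + t) powr (-2 * s)"
    let ?S = "\<Sum>c\<in>initial. ?f c"
    have fin: "finite initial" by simp
    have range: "1 \<le> real c" "real c \<le> 76" if "c \<in> initial" for c
      using that unfolding initial_eq by auto
    have a76: "(76 + t) powr (-2 * s) \<le> ?f a"
      using range[OF a] s t by (intro powr_mono2') auto
    have "?S \<le> (\<Sum>c\<in>initial. (1 + t) powr (-2 * s))"
      using range s t by (intro sum_mono powr_mono2') auto
    also have "\<dots> \<le> 10 * (1 + t) powr (-2 * s)"
      unfolding initial_eq by simp
    finally have S: "?S \<le> 10 * (1 + t) powr (-2 * s)" .
    have "76 powr (-4) * (1 + t) powr (-2 * s) \<le> 76 powr (-2 * s) * (1 + t) powr (-2 * s)"
      using s by (intro mult_right_mono powr_mono) auto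
    also have "\<dots> = (76 * (1 + t)) powr (-2 * s)" by (rule powr_mult[symmetric])
    also have "\<dots> \<le> (76 + t) powr (-2 * s)" using s t by (intro powr_mono2') auto
    finally have "76 powr (-4) * (1 + t) powr (-2 * s) \<le> ?f a" using a76 by linarith
    moreover have "\<eta> * ?S \<le> \<eta> * (10 * (1 + t) powr (-2 * s))"
      using S \<eta> by (intro mult_left_mono) auto
    moreover have "\<eta> * (10 * (1 + t) powr (-2 * s)) = 76 powr (-4) * (1 + t) powr (-2 * s)"
      by (simp add: \<eta>_def)
    ultimately have fa: "\<eta> * ?S \<le> ?f a" by linarith
    have "lucas_set - {a} \<subseteq> (initial - {a}) \<union> lucas ` {10..}"
    proof
      fix c assume c: "c \<in> lucas_set - {a}"
      then obtain n where n: "c = lucas n" by (auto simp: lucas_set_def)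
      have "n \<le> 9 \<or> 10 \<le> n" by linarith
      then show "c \<in> (initial - {a}) \<union> lucas ` {10..}" using n c by blast
    qed
    then have "digit_sum (lucas_set - {a}) s t \<le> digit_sum ((initial - {a}) \<union> lucas ` {10..}) s t"
      by (rule digit_sum_mono)
    also have "\<dots> \<le> digit_sum (initial - {a}) s t + digit_sum (lucas ` {10..}) s t"
      by (rule digit_sum_Un_le)
    also have "\<dots> \<le> digit_sum (initial - {a}) s t + ennreal (\<kappa> * (76 + t) powr (-2 * s))"
      unfolding \<kappa>_def using s t by (intro add_left_mono lucas_tail_digit_sum) auto
    also have "\<dots> \<le> digit_sum (initial - {a}) s t + ennreal (\<kappa> * ?f a)"
      using a76 \<kappa> by (intro add_left_mono ennreal_leI mult_left_mono) auto
    also have "digit_sum (initial - {a}) s t = ennreal (?S - ?f a)"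
      using a fin by (simp add: digit_sum_finite sum_diff1)
    also have "ennreal (?S - ?f a) + ennreal (\<kappa> * ?f a) = ennreal (?S - ?f a + \<kappa> * ?f a)"
      using \<kappa> member_le_sum[OF a _ fin, of ?f] by (intro ennreal_plus[symmetric]) auto
    also have "\<dots> \<le> ennreal (r * ?S)"
    proof (rule ennreal_leI)
      have "(1 - \<kappa>) * (\<eta> * ?S) \<le> (1 - \<kappa>) * ?f a" using fa \<kappa> by (intro mult_left_mono) auto
      then show "?S - ?f a + \<kappa> * ?f a \<le> r * ?S" by (simp add: r_def algebra_simps)
    qed
    also have "\<dots> = ennreal r * digit_sum initial s t"
      using r by (simp add: digit_sum_finite ennreal_mult sum_nonneg)
    finally show ?thesis .
  qed
  then show ?thesis using r by blast
qed

text \<open>Counterpart of \<open>word_sum_growth\<close>: bounded digits let continuants grow at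
  most exponentially, so a small change of exponent costs a factor near 1 per digit.\<close>

lemma word_sum_decay_le:
  assumes A: "0 \<notin> A" and M: "\<And>c. c \<in> A \<Longrightarrow> real c + 1 \<le> M" "1 \<le> M" and "r \<le> s"
  shows "word_sum A r k \<le> ennreal (M powr (2 * (s - r))) ^ k * word_sum A s k"
proof -
  have "word_sum A r k \<le> (\<integral>\<^sup>+w. ennreal (M powr (2 * (s - r))) ^ k * ennreal (cden w 0 powr (-2 * s))
      \<partial>count_space (words A k))"
    unfolding word_sum_def
  proof (rule nn_integral_mono)
    fix w assume "w \<in> space (count_space (words A k))"
    then have w: "0 \<notin> set w" "length w = k" "set w \<subseteq> A" using words_pos[OF A] by (auto simp: words_def)
    have q: "0 < cden w 0" using cden_pos[OF w(1)] by simp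
    have "cden w 0 \<le> M ^ k" using cden_le[OF w(1), of M] M w by auto
    then have "cden w 0 powr (2 * (s - r)) \<le> (M ^ k) powr (2 * (s - r))"
      using q assms by (intro powr_mono2) auto
    also have "\<dots> = (M powr (2 * (s - r))) ^ k"
      by (rule power_powr)
    finally have "cden w 0 powr (2 * (s - r)) * cden w 0 powr (-2 * s) \<le>
      (M powr (2 * (s - r))) ^ k * cden w 0 powr (-2 * s)"
      by (intro mult_right_mono) auto
    moreover have "cden w 0 powr (2 * (s - r)) * cden w 0 powr (-2 * s) = cden w 0 powr (-2 * r)"
      by (simp add: algebra_simps flip: powr_add)
    ultimately show "ennreal (cden w 0 powr (-2 * r)) \<le>
      ennreal (M powr (2 * (s - r))) ^ k * ennreal (cden w 0 powr (-2 * s))"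
      by (simp add: ennreal_leI ennreal_power flip: ennreal_mult)
  qed
  also have "\<dots> = ennreal (M powr (2 * (s - r))) ^ k * word_sum A s k"
    unfolding word_sum_def by (subst nn_integral_cmult) auto
  finally show ?thesis .
qed

lemma dim_initial_ge: "3 / 4 \<le> hausdorff_dim (cf_set initial)"
proof -
  have "hausdorff_dim (cf_set {1, 2, 3, 4, 7}) \<le> hausdorff_dim (cf_set initial)"
    by (intro cf_dim_mono) (auto simp: initial_eq)
  then show ?thesis using dim_12347_ge by linarith
qed

text \<open>Just above its dimension the ten-digit set has a word sum below 1. Descending from
  \<open>?H + e\<close> to \<open>?H - e\<close> costs the factor \<open>77 powr (4 * e)\<close> per
  digit, and omitting \<open>a\<close> gains the factor \<open>r\<close>; for small \<open>e\<close>
  the gain prevails.\<close>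

lemma dim_omit_initial:
  "\<exists>e. 0 < e \<and> e \<le> 1 / 100 \<and> (\<forall>a\<in>initial.
    hausdorff_dim (cf_set (lucas_set - {a})) \<le> hausdorff_dim (cf_set initial) - e)"
proof -
  let ?H = "hausdorff_dim (cf_set initial)"
  obtain r where r: "0 < r" "r < 1" "\<And>a s t. a \<in> initial \<Longrightarrow> 37 / 50 \<le> s \<Longrightarrow> s \<le> 2 \<Longrightarrow> 0 \<le> t \<Longrightarrow>
    t \<le> 2 \<Longrightarrow> digit_sum (lucas_set - {a}) s t \<le> ennreal r * digit_sum initial s t"
    using omit_initial_digit_sum by metis
  have i0: "0 \<notin> initial" by (rule zero_notin_lucas)
  have H: "3 / 4 \<le> ?H" "?H \<le> 2" using dim_initial_ge cf_dim_le_2[OF i0] by auto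
  \<comment> \<open>The second bound is equivalent to \<open>r * 77 powr (4 * e) \<le> 1\<close>,
    where 77 is the largest digit plus 1. The first keeps \<open>?H - e\<close> at or above
    \<open>37 / 50\<close>.\<close>
  define e where "e = min (1 / 100) (- ln r / (4 * ln 77))"
  have e: "0 < e" "e \<le> 1 / 100" using r(1,2) by (auto simp: e_def divide_neg_pos)
  have "4 * e * ln 77 \<le> - ln r"
  proof -
    have "e \<le> - ln r / (4 * ln 77)" by (simp add: e_def)
    then show ?thesis by (simp add: field_simps)
  qed
  then have "exp (4 * e * ln 77) \<le> exp (- ln r)" by simp
  then have "77 powr (4 * e) \<le> 1 / r" using r(1) by (simp add: powr_def exp_minus inverse_eq_divide)
  then have r77: "r * 77 powr (4 * e) \<le> 1" using r(1) by (simp add: field_simps)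
  have "hausdorff_dim (cf_set (lucas_set - {a})) \<le> ?H - e" if a: "a \<in> initial" for a
  proof -
    obtain k where k: "word_sum initial (?H + e) k < 1"
      using word_sum_less_1_of_dim_less[OF i0, of "?H + e"] e by auto
    have l0: "0 \<notin> lucas_set - {a}" using zero_notin_lucas by (auto simp: lucas_set_def)
    have "word_sum (lucas_set - {a}) (?H - e) k \<le> ennreal r ^ k * word_sum initial (?H - e) k"
      using a H e by (intro word_sum_le_of_digit_sum[OF i0 l0] r) auto
    also have "\<dots> \<le> ennreal r ^ k * (ennreal (77 powr (2 * ((?H + e) - (?H - e)))) ^ k * word_sum initial (?H + e) k)"
      using e by (intro mult_left_mono word_sum_decay_le[OF i0]) (auto simp: initial_eq)
    also have "\<dots> = ennreal (r * 77 powr (4 * e)) ^ k * word_sum initial (?H + e) k"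
      using r(1) by (simp add: ennreal_mult power_mult_distrib mult.assoc)
    also have "\<dots> \<le> 1 ^ k * word_sum initial (?H + e) k"
      using r77 by (intro mult_right_mono power_mono) auto
    also have "\<dots> < 1" using k by simp
    finally show ?thesis using H e by (intro cf_dim_le_of_word_sum[OF l0]) auto
  qed
  then show ?thesis using e by blast
qed

theorem theorem1p3:
  shows "(\<exists>s::real. 0 < s \<and> s < hausdorff_dim (cf_set lucas_set) \<and>
            {0..s} \<subseteq> dim_spectrum lucas_set) \<and>
         (\<exists>a b::real. 0 < a \<and> a < b \<and> b < hausdorff_dim (cf_set lucas_set) \<and>
            {a<..<b} \<inter> dim_spectrum lucas_set = {})"
proof -
  let ?D = "hausdorff_dim (cf_set lucas_set)" and ?H = "hausdorff_dim (cf_set initial)"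
  have l0: "0 \<notin> lucas_set" unfolding lucas_set_def by (rule zero_notin_lucas)
  have HD: "?H \<le> ?D" by (rule cf_dim_mono[OF _ l0]) (auto simp: lucas_set_def)
  have H: "3 / 4 \<le> ?H" by (rule dim_initial_ge)
  have "t \<in> dim_spectrum lucas_set" if "0 \<le> t" "t \<le> 1 / 4" for t
  proof (cases "t = 0")
    case True
    then show ?thesis unfolding dim_spectrum_def using dim_empty by (intro CollectI exI[of _ "{}"]) simp
  qed (use that HD H in \<open>auto intro: small_dim_attained\<close>)
  then have "0 < (1 / 4 :: real) \<and> 1 / 4 < ?D \<and> {0..1 / 4} \<subseteq> dim_spectrum lucas_set"
    using HD H by auto
  moreover obtain e where e: "0 < e" "e \<le> 1 / 100"
    "\<And>a. a \<in> initial \<Longrightarrow> hausdorff_dim (cf_set (lucas_set - {a})) \<le> ?H - e"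
    using dim_omit_initial by blast
  \<comment> \<open>Sets with all ten digits have dimension at least \<open>?H\<close>, the others
    at most \<open>?H - e\<close>. The upper end \<open>?H - e / 2\<close> is strictly below the
    full dimension even if \<open>?H\<close> were equal to it.\<close>
  have "x \<notin> dim_spectrum lucas_set" if x: "?H - e < x" "x < ?H - e / 2" for x
  proof
    assume "x \<in> dim_spectrum lucas_set"
    then obtain A where A: "A \<subseteq> lucas_set" "x = hausdorff_dim (cf_set A)"
      by (auto simp: dim_spectrum_def)
    have A0: "0 \<notin> A" using A l0 by blast
    show False
    proof (cases "initial \<subseteq> A")
      case True
      then have "?H \<le> x" unfolding A(2) using A0 by (rule cf_dim_mono)
      then show False using x e by linarith
    next
      case False
      then obtain a where a: "a \<in> initial" "A \<subseteq> lucas_set - {a}" using A by blast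
      have "x \<le> hausdorff_dim (cf_set (lucas_set - {a}))"
        unfolding A(2) using a l0 by (intro cf_dim_mono) auto
      then show False using e(3)[OF a(1)] x by linarith
    qed
  qed
  then have "0 < ?H - e \<and> ?H - e < ?H - e / 2 \<and> ?H - e / 2 < ?D \<and>
      {?H - e<..<?H - e / 2} \<inter> dim_spectrum lucas_set = {}"
    using e H HD by auto
  ultimately show ?thesis by blast
qed

end
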